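(* Let $E_1,\dots,E_m$ and $F$ be Banach spaces. If each $E_i$ has the Schur property and the projective tensor product $E_1\hat{\otimes}_{\pi}\cdots\hat{\otimes}_{\pi}E_m$ also has the Schur property, then $\mathcal{DP}\circ\mathcal{L}(E_1,\dots,E_m;F)=\mathcal{L}_{WDP^{*}}^{\mathrm{ev}}(E_1,\dots,E_m;F)$.
   Context: Banach spaces are over $\mathbb{K}=\mathbb{R}$ or $\mathbb{C}$; $F'$ is the topological dual of $F$; $\overset{w}{\to}$ denotes weak convergence of sequences and $\overset{w^*}{\to}$ denotes convergence of sequences in $F'$ for $\sigma(F',F)$; $\mathcal{L}(E_1,\dots,E_m;F)$ is the space of continuous $m$-linear operators; $E_1\hat{\otimes}_{\pi}\cdots\hat{\otimes}_{\pi}E_m$ is the completed projective tensor product. A Banach space has the Schur property if every weakly convergent sequence in it converges in norm. A bounded linear operator $u\colon G\to F$ is Dunford–Pettis, $u\in\mathcal{DP}(G;F)$, if $x_j\overset{w}{\to}0$ in $G$ implies $\|u(x_j)\|\to0$. $\mathcal{DP}\circ\mathcal{L}(E_1,\dots,E_m;F)$ is the set of all $T\in\mathcal{L}(E_1,\dots,E_m;F)$ of the form $T=u\circ S$ with $G$ a Banach space, $S\in\mathcal{L}(E_1,\dots,E_m;G)$ and $u\in\mathcal{DP}(G;F)$. $T\in\mathcal{L}_{WDP^{*}}^{\mathrm{ev}}(E_1,\dots,E_m;F)$ if $T\in\mathcal{L}(E_1,\dots,E_m;F)$ and for all $(a_1,\dots,a_m)\in E_1\times\cdots\times E_m$, all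 sequences $x_j^{(i)}\overset{w}{\to}a_i$ in $E_i$ ($i=1,\dots,m$), and all sequences $f_j\overset{w^*}{\to}f$ in $F'$ with $f\in F'$, one has $f_j(T(x_j^{(1)},\dots,x_j^{(m)}))\to f(T(a_1,\dots,a_m))$. *)

theory Defs
  imports
    "HOL-Analysis.Analysis"
    "HOL-Algebra.Module"
    "HOL-Algebra.Algebraic_Closure_Type"
    "HOL-Library.Poly_Mapping"
begin

section \<open>Normed and Banach spaces\<close>

text \<open>
  A finite family of different Banach spaces, and an existential quantifier over Banach spaces,
  are needed, so the spaces are carrier-based: a normed space is a HOL-Algebra module over the
  scalar field, extended by a norm. The carriers of \<open>E\<^sub>1, \<dots>, E\<^sub>m\<close> are subsets of one type
  \<open>'a\<close>; this is no restriction on a finite family, as \<open>'a\<close> may be a disjoint sum. The record fields \<open>mult\<close> and \<open>one\<close> inherited from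
  \<open>ring\<close> play no role.

  The scalar field is a type of class \<open>real_normed_field\<close>. By the Gelfand-Mazur theorem such a
  type is, up to isometric isomorphism, \<open>real\<close> or \<open>complex\<close>.
\<close>

record ('k, 'a) normed_module = "('k, 'a) module" +
  nrm :: "'a \<Rightarrow> real"

text \<open>
  The library locale \<open>Metric_space\<close> requires symmetry and nonnegativity also off the carrier;
  hence the case distinction.
\<close>

definition norm_dist :: "('k, 'a) normed_module \<Rightarrow> 'a \<Rightarrow> 'a \<Rightarrow> real" where
  "norm_dist V x y =
     (if x \<in> carrier V \<and> y \<in> carrier V then nrm V (x \<ominus>\<^bsub>V\<^esub> y) else 0)"

definition norm_metric :: "('k, 'a) normed_module \<Rightarrow> 'a metric" where
  "norm_metric V = metric (carrier V, norm_dist V)"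

definition norm_topology :: "('k, 'a) normed_module \<Rightarrow> 'a topology" where
  "norm_topology V = mtopology_of (norm_metric V)"

locale normed_space =
  Module.module "ring_of_type_algebra :: 'k::real_normed_field ring" V
  for V :: "('k::real_normed_field, 'a) normed_module" (structure) +
  assumes nrm_nonneg: "x \<in> carrier V \<Longrightarrow> 0 \<le> nrm V x"
    and nrm_eq_0_iff: "x \<in> carrier V \<Longrightarrow> nrm V x = 0 \<longleftrightarrow> x = \<zero>"
    and nrm_triangle: "x \<in> carrier V \<Longrightarrow> y \<in> carrier V \<Longrightarrow> nrm V (x \<oplus> y) \<le> nrm V x + nrm V y"
    and nrm_smult: "x \<in> carrier V \<Longrightarrow> nrm V (c \<odot>\<^bsub>V\<^esub> x) = norm c * nrm V x"
begin

lemma nrm_a_inv: "x \<in> carrier V \<Longrightarrow> nrm V (\<ominus> x) = nrm V x"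
proof -
  assume x: "x \<in> carrier V"
  have "\<ominus> x = (\<ominus>\<^bsub>ring_of_type_algebra\<^esub> (1::'k)) \<odot>\<^bsub>V\<^esub> x"
    using smult_l_minus[of 1 x] smult_one[OF x] x by (simp add: ring_of_type_algebra_def)
  moreover have "\<ominus>\<^bsub>ring_of_type_algebra\<^esub> (1::'k) = - 1"
  proof -
    have "(-1) \<oplus>\<^bsub>ring_of_type_algebra\<^esub> (1::'k) = \<zero>\<^bsub>ring_of_type_algebra\<^esub>"
      by (simp add: ring_of_type_algebra_def)
    then show ?thesis
      using R.minus_equality[of "-1" "1::'k"] by (simp add: ring_of_type_algebra_def)
  qed
  ultimately show ?thesis using nrm_smult[OF x, of "-1"] by simp
qed

lemma Metric_space_norm_dist: "Metric_space (carrier V) (norm_dist V)"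
proof
  fix x y
  show "0 \<le> norm_dist V x y" by (simp add: norm_dist_def nrm_nonneg)
  show "norm_dist V x y = norm_dist V y x"
    using nrm_a_inv[of "x \<ominus> y"] by (auto simp: norm_dist_def minus_eq minus_add a_comm)
next
  fix x y assume "x \<in> carrier V" "y \<in> carrier V"
  moreover from this have "x \<ominus> y = \<zero> \<longleftrightarrow> x = y"
    using minus_equality[of x "\<ominus> y"] by (auto simp: minus_eq r_neg)
  ultimately show "norm_dist V x y = 0 \<longleftrightarrow> x = y"
    by (simp add: norm_dist_def nrm_eq_0_iff)
next
  fix x y z assume xyz: "x \<in> carrier V" "y \<in> carrier V" "z \<in> carrier V"
  then have "x \<ominus> z = (x \<ominus> y) \<oplus> (y \<ominus> z)"
    by (simp add: minus_eq a_assoc r_neg1)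
  with xyz show "norm_dist V x z \<le> norm_dist V x y + norm_dist V y z"
    using nrm_triangle[of "x \<ominus> y" "y \<ominus> z"] by (simp add: norm_dist_def)
qed

end

locale banach_space = normed_space +
  assumes complete: "mcomplete_of (norm_metric V)"


section \<open>Duals, weak convergence, the Schur property\<close>

text \<open>
  Functionals and linear operators are compared on carriers only, so no convention is imposed on
  their values elsewhere.
\<close>

definition lin_map :: "('k, 'a) normed_module \<Rightarrow> ('k, 'b) normed_module \<Rightarrow> ('a \<Rightarrow> 'b) \<Rightarrow> bool" where
  "lin_map V W u \<longleftrightarrow>
     u \<in> carrier V \<rightarrow> carrier W \<and>
     (\<forall>x\<in>carrier V. \<forall>y\<in>carrier V. u (x \<oplus>\<^bsub>V\<^esub> y) = u x \<oplus>\<^bsub>W\<^esub> u y) \<and>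
     (\<forall>c. \<forall>x\<in>carrier V. u (c \<odot>\<^bsub>V\<^esub> x) = c \<odot>\<^bsub>W\<^esub> u x)"

definition dual :: "('k::real_normed_field, 'a) normed_module \<Rightarrow> ('a \<Rightarrow> 'k) set" where
  "dual V = {f.
     (\<forall>x\<in>carrier V. \<forall>y\<in>carrier V. f (x \<oplus>\<^bsub>V\<^esub> y) = f x + f y) \<and>
     (\<forall>c. \<forall>x\<in>carrier V. f (c \<odot>\<^bsub>V\<^esub> x) = c * f x) \<and>
     continuous_map (norm_topology V) euclidean f}"

definition weakly_converges ::
    "('k::real_normed_field, 'a) normed_module \<Rightarrow> (nat \<Rightarrow> 'a) \<Rightarrow> 'a \<Rightarrow> bool" where
  "weakly_converges V x a \<longleftrightarrow>
     range x \<subseteq> carrier V \<and> a \<in> carrier V \<and> (\<forall>f\<in>dual V. (\<lambda>j. f (x j)) \<longlonglongrightarrow> f a)"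

definition weak_star_converges ::
    "('k::real_normed_field, 'a) normed_module \<Rightarrow> (nat \<Rightarrow> 'a \<Rightarrow> 'k) \<Rightarrow> ('a \<Rightarrow> 'k) \<Rightarrow> bool" where
  "weak_star_converges V \<phi> f \<longleftrightarrow>
     range \<phi> \<subseteq> dual V \<and> f \<in> dual V \<and> (\<forall>x\<in>carrier V. (\<lambda>j. \<phi> j x) \<longlonglongrightarrow> f x)"

definition schur_property :: "('k::real_normed_field, 'a) normed_module \<Rightarrow> bool" where
  "schur_property V \<longleftrightarrow>
     (\<forall>x a. weakly_converges V x a \<longrightarrow> (\<exists>l. limitin (norm_topology V) x l sequentially))"


section \<open>Multilinear operators\<close>

text \<open>The elements of \<open>E\<^sub>1 \<times> \<dots> \<times> E\<^sub>m\<close> are the extensional functions on \<open>{1..m}\<close>.\<close>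

definition tuples :: "nat \<Rightarrow> (nat \<Rightarrow> ('k, 'a) normed_module) \<Rightarrow> (nat \<Rightarrow> 'a) set" where
  "tuples m E = (\<Pi>\<^sub>E i\<in>{1..m}. carrier (E i))"

definition multilinear ::
    "nat \<Rightarrow> (nat \<Rightarrow> ('k, 'a) normed_module) \<Rightarrow> ('k, 'b) normed_module \<Rightarrow> ((nat \<Rightarrow> 'a) \<Rightarrow> 'b) \<Rightarrow> bool" where
  "multilinear m E F T \<longleftrightarrow>
     (\<forall>x\<in>tuples m E. \<forall>i\<in>{1..m}.
        (\<forall>a\<in>carrier (E i). \<forall>b\<in>carrier (E i).
           T (x(i := a \<oplus>\<^bsub>E i\<^esub> b)) = T (x(i := a)) \<oplus>\<^bsub>F\<^esub> T (x(i := b))) \<and>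
        (\<forall>c. \<forall>a\<in>carrier (E i). T (x(i := c \<odot>\<^bsub>E i\<^esub> a)) = c \<odot>\<^bsub>F\<^esub> T (x(i := a))))"

definition cont_multilinear ::
    "nat \<Rightarrow> (nat \<Rightarrow> ('k, 'a) normed_module) \<Rightarrow> ('k, 'b) normed_module \<Rightarrow> ((nat \<Rightarrow> 'a) \<Rightarrow> 'b) set" where
  "cont_multilinear m E F = {T \<in> tuples m E \<rightarrow>\<^sub>E carrier F.
     multilinear m E F T \<and>
     continuous_map (product_topology (\<lambda>i. norm_topology (E i)) {1..m}) (norm_topology F) T}"


section \<open>Dunford--Pettis operators and the two classes of multilinear operators\<close>

definition dunford_pettis ::
    "('k::real_normed_field, 'a) normed_module \<Rightarrow> ('k, 'b) normed_module \<Rightarrow> ('a \<Rightarrow> 'b) set" where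
  "dunford_pettis G F = {u. lin_map G F u \<and>
     (\<exists>C. \<forall>x\<in>carrier G. nrm F (u x) \<le> C * nrm G x) \<and>
     (\<forall>x. weakly_converges G x \<zero>\<^bsub>G\<^esub> \<longrightarrow> (\<lambda>j. nrm F (u (x j))) \<longlonglongrightarrow> 0)}"

text \<open>
  The intermediate Banach space \<open>G\<close> ranges over all Banach spaces whose carrier is a subset of
  the type \<open>'g\<close> given by the first argument, since HOL cannot quantify over types inside a formula.
  Instantiated with a sum type \<open>'g + 'c\<close> for a type variable \<open>'g\<close>, it ranges over (copies of) all
  Banach spaces on an arbitrary type \<open>'g\<close>, and has room for those on the fixed type \<open>'c\<close>.
\<close>

definition DP_comp_L ::
    "'g itself \<Rightarrow> nat \<Rightarrow> (nat \<Rightarrow> ('k::real_normed_field, 'a) normed_module) \<Rightarrow>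
     ('k, 'b) normed_module \<Rightarrow> ((nat \<Rightarrow> 'a) \<Rightarrow> 'b) set" where
  "DP_comp_L _ m E F = {T \<in> cont_multilinear m E F.
     \<exists>(G :: ('k, 'g) normed_module) S u.
       banach_space G \<and> S \<in> cont_multilinear m E G \<and> u \<in> dunford_pettis G F \<and>
       (\<forall>x\<in>tuples m E. T x = u (S x))}"

definition L_WDP_star_ev ::
    "nat \<Rightarrow> (nat \<Rightarrow> ('k::real_normed_field, 'a) normed_module) \<Rightarrow>
     ('k, 'b) normed_module \<Rightarrow> ((nat \<Rightarrow> 'a) \<Rightarrow> 'b) set" where
  "L_WDP_star_ev m E F = {T \<in> cont_multilinear m E F.
     \<forall>a\<in>tuples m E. \<forall>x :: nat \<Rightarrow> nat \<Rightarrow> 'a. \<forall>\<phi> f.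
       (\<forall>i\<in>{1..m}. weakly_converges (E i) (x i) (a i)) \<longrightarrow>
       weak_star_converges F \<phi> f \<longrightarrow>
       (\<lambda>j. \<phi> j (T (\<lambda>i\<in>{1..m}. x i j))) \<longlonglongrightarrow> f (T a)}"


section \<open>The completed projective tensor product\<close>

subsection \<open>The algebraic tensor product with the projective norm\<close>

text \<open>
  The free vector space on \<open>E\<^sub>1 \<times> \<dots> \<times> E\<^sub>m\<close> consists of the finitely supported functions with
  support in \<open>tuples m E\<close>. The tensor product is its quotient by the span of the multilinearity
  relations.
\<close>

definition pm_scale :: "'k::field \<Rightarrow> ('x \<Rightarrow>\<^sub>0 'k) \<Rightarrow> ('x \<Rightarrow>\<^sub>0 'k)" where
  "pm_scale c = Poly_Mapping.map ((*) c)"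

global_interpretation pm: vector_space "pm_scale :: 'k::field \<Rightarrow> ('x \<Rightarrow>\<^sub>0 'k) \<Rightarrow> ('x \<Rightarrow>\<^sub>0 'k)"
proof -
  have lookup: "Poly_Mapping.lookup (pm_scale c p) x = c * Poly_Mapping.lookup p x"
    for c :: 'k and p :: "'x \<Rightarrow>\<^sub>0 'k" and x
    by (simp add: pm_scale_def Poly_Mapping.map.rep_eq when_def)
  show "vector_space (pm_scale :: 'k \<Rightarrow> ('x \<Rightarrow>\<^sub>0 'k) \<Rightarrow> ('x \<Rightarrow>\<^sub>0 'k))"
    by standard (auto intro!: poly_mapping_eqI simp: lookup lookup_add algebra_simps)
qed

definition free_space :: "nat \<Rightarrow> (nat \<Rightarrow> ('k::field, 'a) normed_module) \<Rightarrow> ((nat \<Rightarrow> 'a) \<Rightarrow>\<^sub>0 'k) set" where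
  "free_space m E = {p. Poly_Mapping.keys p \<subseteq> tuples m E}"

definition tensor_relations ::
    "nat \<Rightarrow> (nat \<Rightarrow> ('k::field, 'a) normed_module) \<Rightarrow> ((nat \<Rightarrow> 'a) \<Rightarrow>\<^sub>0 'k) set" where
  "tensor_relations m E =
     {Poly_Mapping.single (x(i := a \<oplus>\<^bsub>E i\<^esub> b)) 1
        - Poly_Mapping.single (x(i := a)) 1 - Poly_Mapping.single (x(i := b)) 1 | x i a b.
        x \<in> tuples m E \<and> i \<in> {1..m} \<and> a \<in> carrier (E i) \<and> b \<in> carrier (E i)} \<union>
     {Poly_Mapping.single (x(i := c \<odot>\<^bsub>E i\<^esub> a)) 1
        - pm_scale c (Poly_Mapping.single (x(i := a)) 1) | x i c a.
        x \<in> tuples m E \<and> i \<in> {1..m} \<and> a \<in> carrier (E i)}"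

definition tensor_equiv ::
    "nat \<Rightarrow> (nat \<Rightarrow> ('k::field, 'a) normed_module) \<Rightarrow>
     (((nat \<Rightarrow> 'a) \<Rightarrow>\<^sub>0 'k) \<times> ((nat \<Rightarrow> 'a) \<Rightarrow>\<^sub>0 'k)) set" where
  "tensor_equiv m E = {(p, q). p \<in> free_space m E \<and> q \<in> free_space m E \<and>
     p - q \<in> pm.span (tensor_relations m E)}"

text \<open>
  An equivalence class \<open>A\<close> is the set of all formal sums \<open>\<Sum>\<^sub>j \<lambda>\<^sub>j \<cdot> x\<^sub>j\<close> with
  \<open>\<Sum>\<^sub>j \<lambda>\<^sub>j x\<^sub>j\<^sup>1 \<otimes> \<dots> \<otimes> x\<^sub>j\<^sup>m = A\<close>, so the norm below is the infimum of
  \<open>\<Sum>\<^sub>j |\<lambda>\<^sub>j| \<parallel>x\<^sub>j\<^sup>1\<parallel> \<cdots> \<parallel>x\<^sub>j\<^sup>m\<parallel>\<close> over all representations of the tensor \<open>A\<close>.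
\<close>

definition tensor_space ::
    "nat \<Rightarrow> (nat \<Rightarrow> ('k::real_normed_field, 'a) normed_module) \<Rightarrow>
     ('k, ((nat \<Rightarrow> 'a) \<Rightarrow>\<^sub>0 'k) set) normed_module" where
  "tensor_space m E =
     \<lparr>carrier = free_space m E // tensor_equiv m E,
      monoid.mult = undefined,
      one = undefined,
      ring.zero = tensor_equiv m E `` {0},
      add = (\<lambda>A B. \<Union>p\<in>A. \<Union>q\<in>B. tensor_equiv m E `` {p + q}),
      smult = (\<lambda>c A. \<Union>p\<in>A. tensor_equiv m E `` {pm_scale c p}),
      nrm = (\<lambda>A. INF p\<in>A. \<Sum>x\<in>Poly_Mapping.keys p.
               norm (Poly_Mapping.lookup p x) * (\<Prod>i\<in>{1..m}. nrm (E i) (x i)))\<rparr>"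


subsection \<open>Completion\<close>

text \<open>Cauchy sequences modulo null sequences.\<close>

definition cauchy_seqs :: "('k, 'a) normed_module \<Rightarrow> (nat \<Rightarrow> 'a) set" where
  "cauchy_seqs V = {s. range s \<subseteq> carrier V \<and>
     (\<forall>\<epsilon>>0. \<exists>N. \<forall>n\<ge>N. \<forall>n'\<ge>N. nrm V (s n \<ominus>\<^bsub>V\<^esub> s n') < \<epsilon>)}"

definition cauchy_equiv :: "('k, 'a) normed_module \<Rightarrow> ((nat \<Rightarrow> 'a) \<times> (nat \<Rightarrow> 'a)) set" where
  "cauchy_equiv V = {(s, t). s \<in> cauchy_seqs V \<and> t \<in> cauchy_seqs V \<and>
     (\<lambda>n. nrm V (s n \<ominus>\<^bsub>V\<^esub> t n)) \<longlonglongrightarrow> 0}"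

definition completion :: "('k, 'a) normed_module \<Rightarrow> ('k, (nat \<Rightarrow> 'a) set) normed_module" where
  "completion V =
     \<lparr>carrier = cauchy_seqs V // cauchy_equiv V,
      monoid.mult = undefined,
      one = undefined,
      ring.zero = cauchy_equiv V `` {\<lambda>_. \<zero>\<^bsub>V\<^esub>},
      add = (\<lambda>A B. \<Union>s\<in>A. \<Union>t\<in>B. cauchy_equiv V `` {\<lambda>n. s n \<oplus>\<^bsub>V\<^esub> t n}),
      smult = (\<lambda>c A. \<Union>s\<in>A. cauchy_equiv V `` {\<lambda>n. c \<odot>\<^bsub>V\<^esub> s n}),
      nrm = (\<lambda>A. THE r. \<exists>s\<in>A. (\<lambda>n. nrm V (s n)) \<longlonglongrightarrow> r)\<rparr>"

type_synonym ('k, 'a) tensor = "(nat \<Rightarrow> ((nat \<Rightarrow> 'a) \<Rightarrow>\<^sub>0 'k) set) set"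

definition proj_tensor ::
    "nat \<Rightarrow> (nat \<Rightarrow> ('k::real_normed_field, 'a) normed_module) \<Rightarrow>
     ('k, ('k, 'a) tensor) normed_module" where
  "proj_tensor m E = completion (tensor_space m E)"

end

theory Submission
  imports Defs
begin

text \<open>
  Under the hypotheses both classes consist of all continuous multilinear operators.

  If every \<open>E\<^sub>i\<close> is Schur, weakly convergent arguments converge in norm, so \<open>T\<close> maps them to a norm
  convergent sequence, and weak-star convergent functionals are uniformly bounded by
  Banach--Steinhaus. Conversely, \<open>T\<close> is the canonical multilinear map into the projective tensor
  product followed by its linearization; a bounded operator on a Schur space is Dunford--Pettis.

  No Hahn--Banach theorem is needed: the projective norm is only used as a seminorm, as the
  completion divides out its null space.
\<close>

section \<open>Seminormed spaces\<close>

text \<open>Separating functionals would normally enter at three places: to see that a nonzero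
  algebraic tensor has positive projective norm, that the norm of an elementary tensor equals the
  product of the norms of its factors, and that a norm limit agrees with a weak limit. The first is
  bypassed by setting up Cauchy sequences, completion and extension of maps for seminorms; for the
  second the inequality \<open>\<le>\<close> suffices, since only continuity of the canonical map is
  wanted; the third is replaced by a property of the Schur hypothesis itself.

  What travels through the factorization is a bound rather than continuity. A constant
  \<open>C\<close> for \<open>T\<close> comes from a box around the zero tuple; linearization and
  extension to the completion both keep this same \<open>C\<close>.

  The existential quantifier over Banach spaces in \<open>DP_comp_L\<close> is confined to carriers
  inside one type, which the theorem takes to be a sum with an arbitrary left summand. The factoring
  space is therefore an isometric copy of the projective tensor product in the right
  summand.\<close>

lemma tendsto_zero_dominated:
  fixes f g :: "'a \<Rightarrow> real"
  assumes "(g \<longlongrightarrow> 0) F" and "\<And>n. 0 \<le> f n" and "\<And>n. f n \<le> g n"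
  shows "(f \<longlongrightarrow> 0) F"
  by (rule Lim_null_comparison[OF _ assms(1)]) (simp add: assms)

lemma scalar_ring_simps [simp]:
  "carrier (ring_of_type_algebra :: 'k::comm_ring_1 ring) = UNIV"
  "a \<oplus>\<^bsub>ring_of_type_algebra\<^esub> b = a + (b::'k)"
  "a \<otimes>\<^bsub>ring_of_type_algebra\<^esub> b = a * (b::'k)"
  "\<one>\<^bsub>ring_of_type_algebra\<^esub> = (1::'k)"
  "\<zero>\<^bsub>ring_of_type_algebra\<^esub> = (0::'k)"
  by (simp_all add: ring_of_type_algebra_def)

text \<open>The open record type lets one locale serve both normed spaces and the plain modules of
  Cauchy sequences and of formal sums, which carry no norm of their own.\<close>

locale scalar_module =
  Module.module "ring_of_type_algebra :: 'k::field ring" V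
  for V :: "('k::field, 'a, 'z) module_scheme" (structure)

text \<open>Additive inverses are not an obligation: distributivity makes
  \<open>(-1) \<odot> x\<close> an inverse of \<open>x\<close>, and \<open>scale_zero\<close> closes
  that computation.\<close>

lemma scalar_moduleI:
  fixes V :: "('k::field, 'a, 'z) module_scheme" (structure)
  assumes add_closed: "\<And>x y. x \<in> carrier V \<Longrightarrow> y \<in> carrier V \<Longrightarrow> x \<oplus> y \<in> carrier V"
    and zero_closed: "\<zero> \<in> carrier V"
    and scale_closed: "\<And>c x. x \<in> carrier V \<Longrightarrow> c \<odot> x \<in> carrier V"
    and assoc: "\<And>x y z. x \<in> carrier V \<Longrightarrow> y \<in> carrier V \<Longrightarrow> z \<in> carrier V \<Longrightarrow>
      (x \<oplus> y) \<oplus> z = x \<oplus> (y \<oplus> z)"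
    and comm: "\<And>x y. x \<in> carrier V \<Longrightarrow> y \<in> carrier V \<Longrightarrow> x \<oplus> y = y \<oplus> x"
    and zero: "\<And>x. x \<in> carrier V \<Longrightarrow> \<zero> \<oplus> x = x"
    and l_distr: "\<And>a b x. x \<in> carrier V \<Longrightarrow> (a + b) \<odot> x = a \<odot> x \<oplus> b \<odot> x"
    and r_distr: "\<And>a x y. x \<in> carrier V \<Longrightarrow> y \<in> carrier V \<Longrightarrow>
      a \<odot> (x \<oplus> y) = a \<odot> x \<oplus> a \<odot> y"
    and scale_scale: "\<And>a b x. x \<in> carrier V \<Longrightarrow> (a * b) \<odot> x = a \<odot> (b \<odot> x)"
    and scale_one: "\<And>x. x \<in> carrier V \<Longrightarrow> 1 \<odot> x = x"
    and scale_zero: "\<And>x. x \<in> carrier V \<Longrightarrow> 0 \<odot> x = \<zero>"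
  shows "scalar_module V"
proof (rule scalar_module.intro[OF moduleI])
  show "cring (ring_of_type_algebra :: 'k ring)"
    by (rule cring_from_type_algebra)
  show "abelian_group V"
  proof (rule abelian_groupI)
    fix x assume x: "x \<in> carrier V"
    have "(-1) \<odot> x \<oplus> x = (-1 + 1) \<odot> x"
      using l_distr[OF x, of "-1" 1] scale_one[OF x] by simp
    then show "\<exists>y\<in>carrier V. y \<oplus> x = \<zero>"
      using scale_closed[OF x] scale_zero[OF x] by auto
  qed (use assms in auto)
qed (use assms in auto)

context scalar_module
begin

lemma scale_closed [simp, intro]: "x \<in> carrier V \<Longrightarrow> c \<odot> x \<in> carrier V"
  by simp

lemma scale_add_left: "x \<in> carrier V \<Longrightarrow> (a + b) \<odot> x = a \<odot> x \<oplus> b \<odot> x"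
  using smult_l_distr[of a b x] by simp

lemma scale_add_right:
  "x \<in> carrier V \<Longrightarrow> y \<in> carrier V \<Longrightarrow> c \<odot> (x \<oplus> y) = c \<odot> x \<oplus> c \<odot> y"
  using smult_r_distr[of c x y] by simp

lemma scale_scale: "x \<in> carrier V \<Longrightarrow> a \<odot> (b \<odot> x) = (a * b) \<odot> x"
  using smult_assoc1[of a b x] by simp

lemma scale_one [simp]: "x \<in> carrier V \<Longrightarrow> 1 \<odot> x = x"
  using smult_one[of x] by simp

lemma scale_zero_left [simp]: "x \<in> carrier V \<Longrightarrow> 0 \<odot> x = \<zero>"
  using smult_l_null[of x] by simp

lemma scale_zero_right [simp]: "c \<odot> \<zero> = \<zero>"
  using smult_r_null[of c] by simp

lemma minus_eq_scale: "x \<in> carrier V \<Longrightarrow> \<ominus> x = (-1) \<odot> x"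
proof -
  assume x: "x \<in> carrier V"
  have "(-1) \<odot> x \<oplus> x = (-1 + 1) \<odot> x"
    using scale_add_left[OF x, of "-1" 1] x by simp
  then show ?thesis
    using x by (intro minus_equality) auto
qed

lemma diff_eq_scale: "x \<in> carrier V \<Longrightarrow> y \<in> carrier V \<Longrightarrow> x \<ominus> y = x \<oplus> (-1) \<odot> y"
  by (simp add: minus_eq minus_eq_scale)

lemma diff_closed [simp, intro]: "x \<in> carrier V \<Longrightarrow> y \<in> carrier V \<Longrightarrow> x \<ominus> y \<in> carrier V"
  by (simp add: minus_eq)

lemma diff_add: "x \<in> carrier V \<Longrightarrow> y \<in> carrier V \<Longrightarrow> (x \<ominus> y) \<oplus> y = x"
  by (simp add: minus_eq a_assoc l_neg)

lemma diff_self: "x \<in> carrier V \<Longrightarrow> x \<ominus> x = \<zero>"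
  by (simp add: minus_eq r_neg)

lemma diff_zero: "x \<in> carrier V \<Longrightarrow> x \<ominus> \<zero> = x"
  by (simp add: minus_eq)

lemma diff_diff_add:
  assumes "x \<in> carrier V" "y \<in> carrier V" "x' \<in> carrier V" "y' \<in> carrier V"
  shows "(x \<oplus> y) \<ominus> (x' \<oplus> y') = (x \<ominus> x') \<oplus> (y \<ominus> y')"
  using assms by (simp add: minus_eq minus_add a_ac)

lemma scale_diff:
  assumes "x \<in> carrier V" "y \<in> carrier V"
  shows "c \<odot> x \<ominus> c \<odot> y = c \<odot> (x \<ominus> y)"
  using assms by (simp add: diff_eq_scale scale_add_right scale_scale)

end

section \<open>Seminorms and their Cauchy sequences\<close>

locale seminormed_space =
  scalar_module V for V :: "('k::real_normed_field, 'a) normed_module" (structure) +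
  assumes seminorm_nonneg: "x \<in> carrier V \<Longrightarrow> 0 \<le> nrm V x"
    and seminorm_triangle:
      "x \<in> carrier V \<Longrightarrow> y \<in> carrier V \<Longrightarrow> nrm V (x \<oplus> y) \<le> nrm V x + nrm V y"
    and seminorm_scale: "x \<in> carrier V \<Longrightarrow> nrm V (c \<odot>\<^bsub>V\<^esub> x) = norm c * nrm V x"
begin

lemma seminorm_zero [simp]: "nrm V \<zero> = 0"
  using seminorm_scale[of \<zero> 0] by simp

lemma seminorm_minus: "x \<in> carrier V \<Longrightarrow> nrm V (\<ominus> x) = nrm V x"
  by (simp add: minus_eq_scale seminorm_scale)

lemma seminorm_diff_commute:
  "x \<in> carrier V \<Longrightarrow> y \<in> carrier V \<Longrightarrow> nrm V (x \<ominus> y) = nrm V (y \<ominus> x)"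
  using seminorm_minus[of "x \<ominus> y"] by (simp add: minus_eq minus_add a_comm)

lemma seminorm_diff_triangle:
  assumes "x \<in> carrier V" "y \<in> carrier V" "z \<in> carrier V"
  shows "nrm V (x \<ominus> z) \<le> nrm V (x \<ominus> y) + nrm V (y \<ominus> z)"
proof -
  have "x \<ominus> z = (x \<ominus> y) \<oplus> (y \<ominus> z)"
    using assms by (simp add: minus_eq a_assoc r_neg1)
  then show ?thesis using assms seminorm_triangle[of "x \<ominus> y" "y \<ominus> z"] by simp
qed

lemma seminorm_le_diff:
  assumes "x \<in> carrier V" "y \<in> carrier V"
  shows "nrm V x \<le> nrm V (x \<ominus> y) + nrm V y"
  using seminorm_triangle[of "x \<ominus> y" y] assms by (simp add: diff_add)

lemma seminorm_reverse_triangle: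
  assumes "x \<in> carrier V" "y \<in> carrier V"
  shows "\<bar>nrm V x - nrm V y\<bar> \<le> nrm V (x \<ominus> y)"
  using seminorm_le_diff[of x y] seminorm_le_diff[of y x] seminorm_diff_commute[of x y] assms
  by simp

lemma seminorm_add_diff:
  assumes "x \<in> carrier V" "y \<in> carrier V" "x' \<in> carrier V" "y' \<in> carrier V"
  shows "nrm V ((x \<oplus> y) \<ominus> (x' \<oplus> y')) \<le> nrm V (x \<ominus> x') + nrm V (y \<ominus> y')"
  using assms by (simp add: diff_diff_add seminorm_triangle)

lemma seminorm_scale_diff:
  assumes "x \<in> carrier V" "y \<in> carrier V"
  shows "nrm V (c \<odot> x \<ominus> c \<odot> y) = norm c * nrm V (x \<ominus> y)"
  using assms by (simp add: scale_diff seminorm_scale)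

lemma cauchy_seqs_carrier: "s \<in> cauchy_seqs V \<Longrightarrow> s n \<in> carrier V"
  by (auto simp: cauchy_seqs_def)

lemma cauchy_seqsD:
  "s \<in> cauchy_seqs V \<Longrightarrow> 0 < e \<Longrightarrow> \<exists>N. \<forall>n\<ge>N. \<forall>n'\<ge>N. nrm V (s n \<ominus> s n') < e"
  by (auto simp: cauchy_seqs_def)

lemma convergent_seminorm_cauchy_seq:
  assumes s: "s \<in> cauchy_seqs V"
  shows "convergent (\<lambda>n. nrm V (s n))"
proof -
  have "Cauchy (\<lambda>n. nrm V (s n))"
  proof (rule CauchyI)
    fix e :: real assume "0 < e"
    then obtain N where N: "\<forall>n\<ge>N. \<forall>n'\<ge>N. nrm V (s n \<ominus> s n') < e"
      using cauchy_seqsD[OF s] by blast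
    show "\<exists>M. \<forall>m\<ge>M. \<forall>n\<ge>M. norm (nrm V (s m) - nrm V (s n)) < e"
    proof (intro exI allI impI)
      fix m n assume "N \<le> m" "N \<le> n"
      then show "norm (nrm V (s m) - nrm V (s n)) < e"
        using seminorm_reverse_triangle[of "s m" "s n"] N s
        by (auto simp: cauchy_seqs_carrier intro: le_less_trans)
    qed
  qed
  then show ?thesis by (simp add: Cauchy_convergent_iff)
qed

lemma cauchy_seqs_const: "x \<in> carrier V \<Longrightarrow> (\<lambda>_. x) \<in> cauchy_seqs V"
  by (auto simp: cauchy_seqs_def diff_self)

lemma cauchy_seqs_add:
  assumes s: "s \<in> cauchy_seqs V" and t: "t \<in> cauchy_seqs V"
  shows "(\<lambda>n. s n \<oplus> t n) \<in> cauchy_seqs V"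
  unfolding cauchy_seqs_def
proof (intro CollectI conjI allI impI)
  show "range (\<lambda>n. s n \<oplus> t n) \<subseteq> carrier V"
    using s t by (auto simp: cauchy_seqs_carrier)
  fix e :: real assume "0 < e"
  then have "0 < e / 2" by simp
  from cauchy_seqsD[OF s this] cauchy_seqsD[OF t this] obtain M N
    where MN: "\<forall>n\<ge>M. \<forall>n'\<ge>M. nrm V (s n \<ominus> s n') < e / 2"
      "\<forall>n\<ge>N. \<forall>n'\<ge>N. nrm V (t n \<ominus> t n') < e / 2" by blast
  show "\<exists>N. \<forall>n\<ge>N. \<forall>n'\<ge>N. nrm V ((s n \<oplus> t n) \<ominus> (s n' \<oplus> t n')) < e"
  proof (intro exI allI impI)
    fix n n' assume "max M N \<le> n" "max M N \<le> n'"
    then have "nrm V (s n \<ominus> s n') < e / 2" "nrm V (t n \<ominus> t n') < e / 2"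
      using MN by auto
    then show "nrm V ((s n \<oplus> t n) \<ominus> (s n' \<oplus> t n')) < e"
      using seminorm_add_diff[of "s n" "t n" "s n'" "t n'"] s t
      by (simp add: cauchy_seqs_carrier)
  qed
qed

lemma cauchy_seqs_scale:
  assumes s: "s \<in> cauchy_seqs V"
  shows "(\<lambda>n. c \<odot> s n) \<in> cauchy_seqs V"
  unfolding cauchy_seqs_def
proof (intro CollectI conjI allI impI)
  show "range (\<lambda>n. c \<odot> s n) \<subseteq> carrier V"
    using s by (auto simp: cauchy_seqs_carrier)
  fix e :: real assume "0 < e"
  \<comment> \<open>The summand 1 keeps the denominator positive when \<open>c = 0\<close>.\<close>
  then have "0 < e / (norm c + 1)" by (simp add: add_nonneg_pos)
  from cauchy_seqsD[OF s this] obtain N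
    where N: "\<forall>n\<ge>N. \<forall>n'\<ge>N. nrm V (s n \<ominus> s n') < e / (norm c + 1)" by blast
  show "\<exists>N. \<forall>n\<ge>N. \<forall>n'\<ge>N. nrm V (c \<odot> s n \<ominus> c \<odot> s n') < e"
  proof (intro exI allI impI)
    fix n n' assume "N \<le> n" "N \<le> n'"
    then have *: "nrm V (s n \<ominus> s n') < e / (norm c + 1)"
      using N by auto
    have "norm c * nrm V (s n \<ominus> s n') \<le> (norm c + 1) * nrm V (s n \<ominus> s n')"
      using s by (intro mult_right_mono) (auto simp: seminorm_nonneg cauchy_seqs_carrier)
    also have "\<dots> < e"
      using * by (simp add: pos_less_divide_eq add_nonneg_pos mult.commute)
    finally show "nrm V (c \<odot> s n \<ominus> c \<odot> s n') < e"
      using s by (simp add: seminorm_scale_diff cauchy_seqs_carrier)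
  qed
qed

lemma cauchy_equiv_iff:
  "(s, t) \<in> cauchy_equiv V \<longleftrightarrow>
    s \<in> cauchy_seqs V \<and> t \<in> cauchy_seqs V \<and> (\<lambda>n. nrm V (s n \<ominus> t n)) \<longlonglongrightarrow> 0"
  by (simp add: cauchy_equiv_def)

lemma equiv_cauchy_equiv: "equiv (cauchy_seqs V) (cauchy_equiv V)"
proof (rule equivI)
  show "cauchy_equiv V \<subseteq> cauchy_seqs V \<times> cauchy_seqs V"
    by (auto simp: cauchy_equiv_iff)
  show "refl_on (cauchy_seqs V) (cauchy_equiv V)"
    by (auto simp: refl_on_def cauchy_equiv_iff diff_self cauchy_seqs_carrier)
  show "sym (cauchy_equiv V)"
    by (rule symI) (auto simp: cauchy_equiv_iff seminorm_diff_commute cauchy_seqs_carrier)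
  show "trans (cauchy_equiv V)"
  proof (rule transI)
    fix s t r assume st: "(s, t) \<in> cauchy_equiv V" and tr: "(t, r) \<in> cauchy_equiv V"
    have "(\<lambda>n. nrm V (s n \<ominus> r n)) \<longlonglongrightarrow> 0"
    proof (rule tendsto_zero_dominated)
      show "(\<lambda>n. nrm V (s n \<ominus> t n) + nrm V (t n \<ominus> r n)) \<longlonglongrightarrow> 0"
        using st tr by (intro tendsto_add_zero) (auto simp: cauchy_equiv_iff)
      show "nrm V (s n \<ominus> r n) \<le> nrm V (s n \<ominus> t n) + nrm V (t n \<ominus> r n)" for n
        using st tr by (intro seminorm_diff_triangle) (auto simp: cauchy_equiv_iff cauchy_seqs_carrier)
      show "0 \<le> nrm V (s n \<ominus> r n)" for n
        using st tr by (intro seminorm_nonneg) (auto simp: cauchy_equiv_iff cauchy_seqs_carrier)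
    qed
    then show "(s, r) \<in> cauchy_equiv V"
      using st tr by (simp add: cauchy_equiv_iff)
  qed
qed

end

sublocale normed_space \<subseteq> seminormed_space
  by unfold_locales (auto simp: nrm_nonneg nrm_triangle nrm_smult)

section \<open>Quotients and completions\<close>

text \<open>Serves two constructions: formal sums modulo the multilinearity relations, and Cauchy
  sequences modulo null sequences. Only the algebraic fields of \<open>Q\<close> are prescribed,
  because the two quotients are normed differently (an infimum and a limit).\<close>

locale quotient_module = scalar_module M
  for M :: "('k::field, 'a) module" (structure) +
  fixes R :: "('a \<times> 'a) set" and Q :: "('k, 'a set) normed_module"
  assumes equiv_R: "equiv (carrier M) R"
    and add_cong: "(x, x') \<in> R \<Longrightarrow> (y, y') \<in> R \<Longrightarrow> (x \<oplus> y, x' \<oplus> y') \<in> R"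
    and scale_cong: "(x, y) \<in> R \<Longrightarrow> (c \<odot> x, c \<odot> y) \<in> R"
    and carrier_Q: "carrier Q = carrier M // R"
    and zero_Q: "\<zero>\<^bsub>Q\<^esub> = R `` {\<zero>}"
    and add_Q: "add Q = (\<lambda>A B. \<Union>x\<in>A. \<Union>y\<in>B. R `` {x \<oplus> y})"
    and smult_Q: "smult Q = (\<lambda>c A. \<Union>x\<in>A. R `` {c \<odot> x})"
begin

lemma class_closed: "x \<in> carrier M \<Longrightarrow> R `` {x} \<in> carrier Q"
  by (simp add: carrier_Q quotientI)

lemma class_cases:
  assumes "A \<in> carrier Q" obtains x where "x \<in> carrier M" "A = R `` {x}"
  using assms by (auto simp: carrier_Q elim: quotientE)

lemma class_eq_iff: "x \<in> carrier M \<Longrightarrow> y \<in> carrier M \<Longrightarrow> R `` {x} = R `` {y} \<longleftrightarrow> (x, y) \<in> R"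
  using eq_equiv_class_iff[OF equiv_R] by simp

lemma in_class_self: "x \<in> carrier M \<Longrightarrow> x \<in> R `` {x}"
  by (rule equiv_class_self[OF equiv_R])

lemma class_add:
  assumes "x \<in> carrier M" "y \<in> carrier M"
  shows "R `` {x} \<oplus>\<^bsub>Q\<^esub> R `` {y} = R `` {x \<oplus> y}"
proof -
  have "congruent2 R R (\<lambda>x y. R `` {x \<oplus> y})"
    by (auto simp: congruent2_def intro!: equiv_class_eq[OF equiv_R] add_cong)
  from UN_equiv_class2[OF equiv_R equiv_R this assms] show ?thesis
    by (simp add: add_Q)
qed

lemma class_scale:
  assumes "x \<in> carrier M"
  shows "c \<odot>\<^bsub>Q\<^esub> R `` {x} = R `` {c \<odot> x}"
proof -
  have "(\<lambda>x. R `` {c \<odot> x}) respects R"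
    by (auto simp: congruent_def intro!: equiv_class_eq[OF equiv_R] scale_cong)
  from UN_equiv_class[OF equiv_R this assms] show ?thesis
    by (simp add: smult_Q)
qed

lemma scalar_module_Q: "scalar_module Q"
proof (rule scalar_moduleI)
  show "\<zero>\<^bsub>Q\<^esub> \<in> carrier Q" by (simp add: zero_Q class_closed)
  fix A assume A: "A \<in> carrier Q"
  show "c \<odot>\<^bsub>Q\<^esub> A \<in> carrier Q" for c
    using A by (auto simp: class_scale class_closed elim!: class_cases)
  show "\<zero>\<^bsub>Q\<^esub> \<oplus>\<^bsub>Q\<^esub> A = A" "(1::'k) \<odot>\<^bsub>Q\<^esub> A = A" "(0::'k) \<odot>\<^bsub>Q\<^esub> A = \<zero>\<^bsub>Q\<^esub>"
    using A by (auto simp: class_scale class_add zero_Q elim!: class_cases)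
  show "(a + b) \<odot>\<^bsub>Q\<^esub> A = a \<odot>\<^bsub>Q\<^esub> A \<oplus>\<^bsub>Q\<^esub> b \<odot>\<^bsub>Q\<^esub> A" "(a * b) \<odot>\<^bsub>Q\<^esub> A = a \<odot>\<^bsub>Q\<^esub> (b \<odot>\<^bsub>Q\<^esub> A)" for a b
    using A by (auto simp: class_scale class_add scale_add_left scale_scale elim!: class_cases)
  fix B assume B: "B \<in> carrier Q"
  show "A \<oplus>\<^bsub>Q\<^esub> B \<in> carrier Q"
    using A B by (auto simp: class_add class_closed elim!: class_cases)
  show "A \<oplus>\<^bsub>Q\<^esub> B = B \<oplus>\<^bsub>Q\<^esub> A"
    using A B by (auto simp: class_add a_comm elim!: class_cases)
  show "a \<odot>\<^bsub>Q\<^esub> (A \<oplus>\<^bsub>Q\<^esub> B) = a \<odot>\<^bsub>Q\<^esub> A \<oplus>\<^bsub>Q\<^esub> a \<odot>\<^bsub>Q\<^esub> B" for a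
    using A B by (auto simp: class_add class_scale scale_add_right elim!: class_cases)
  fix C assume C: "C \<in> carrier Q"
  show "A \<oplus>\<^bsub>Q\<^esub> B \<oplus>\<^bsub>Q\<^esub> C = A \<oplus>\<^bsub>Q\<^esub> (B \<oplus>\<^bsub>Q\<^esub> C)"
    using A B C by (auto simp: class_add a_assoc elim!: class_cases)
qed

lemma class_diff:
  assumes "x \<in> carrier M" "y \<in> carrier M"
  shows "R `` {x} \<ominus>\<^bsub>Q\<^esub> R `` {y} = R `` {x \<ominus> y}"
  using assms
  by (simp add: scalar_module.diff_eq_scale[OF scalar_module_Q] diff_eq_scale class_add class_scale
      class_closed)

end

section \<open>The completion of a seminormed space\<close>

definition cauchy_module :: "('k, 'a) normed_module \<Rightarrow> ('k, nat \<Rightarrow> 'a) module" where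
  "cauchy_module V =
     \<lparr>carrier = cauchy_seqs V, monoid.mult = undefined, one = undefined,
      ring.zero = (\<lambda>_. \<zero>\<^bsub>V\<^esub>), add = (\<lambda>s t n. s n \<oplus>\<^bsub>V\<^esub> t n),
      smult = (\<lambda>c s n. c \<odot>\<^bsub>V\<^esub> s n)\<rparr>"

lemma cauchy_module_simps [simp]:
  "carrier (cauchy_module V) = cauchy_seqs V"
  "\<zero>\<^bsub>cauchy_module V\<^esub> = (\<lambda>_. \<zero>\<^bsub>V\<^esub>)"
  "s \<oplus>\<^bsub>cauchy_module V\<^esub> t = (\<lambda>n. s n \<oplus>\<^bsub>V\<^esub> t n)"
  "c \<odot>\<^bsub>cauchy_module V\<^esub> s = (\<lambda>n. c \<odot>\<^bsub>V\<^esub> s n)"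
  by (simp_all add: cauchy_module_def)

context seminormed_space
begin

lemma scalar_module_cauchy: "scalar_module (cauchy_module V)"
  by (rule scalar_moduleI)
    (auto simp: cauchy_seqs_add cauchy_seqs_scale cauchy_seqs_const cauchy_seqs_carrier a_ac scale_add_left scale_add_right scale_scale)

lemma quotient_module_completion:
  "quotient_module (cauchy_module V) (cauchy_equiv V) (completion V)"
proof (intro quotient_module.intro quotient_module_axioms.intro scalar_module_cauchy)
  show "equiv (carrier (cauchy_module V)) (cauchy_equiv V)"
    by (simp add: equiv_cauchy_equiv)
next
  fix s s' t t' assume st: "(s, s') \<in> cauchy_equiv V" "(t, t') \<in> cauchy_equiv V"
  have "(\<lambda>n. nrm V ((s n \<oplus> t n) \<ominus> (s' n \<oplus> t' n))) \<longlonglongrightarrow> 0"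
  proof (rule tendsto_zero_dominated)
    show "(\<lambda>n. nrm V (s n \<ominus> s' n) + nrm V (t n \<ominus> t' n)) \<longlonglongrightarrow> 0"
      using st by (intro tendsto_add_zero) (auto simp: cauchy_equiv_iff)
    show "nrm V ((s n \<oplus> t n) \<ominus> (s' n \<oplus> t' n)) \<le> nrm V (s n \<ominus> s' n) + nrm V (t n \<ominus> t' n)" for n
      using st by (intro seminorm_add_diff) (auto simp: cauchy_equiv_iff cauchy_seqs_carrier)
    show "0 \<le> nrm V ((s n \<oplus> t n) \<ominus> (s' n \<oplus> t' n))" for n
      using st by (intro seminorm_nonneg) (auto simp: cauchy_equiv_iff cauchy_seqs_carrier)
  qed
  then show "(s \<oplus>\<^bsub>cauchy_module V\<^esub> t, s' \<oplus>\<^bsub>cauchy_module V\<^esub> t') \<in> cauchy_equiv V"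
    using st by (auto simp: cauchy_equiv_iff cauchy_seqs_add)
next
  fix s t c assume st: "(s, t) \<in> cauchy_equiv V"
  then have "(\<lambda>n. nrm V (c \<odot> s n \<ominus> c \<odot> t n)) = (\<lambda>n. norm c * nrm V (s n \<ominus> t n))"
    by (intro ext seminorm_scale_diff) (auto simp: cauchy_equiv_iff cauchy_seqs_carrier)
  moreover have "(\<lambda>n. norm c * nrm V (s n \<ominus> t n)) \<longlonglongrightarrow> 0"
    using st by (intro tendsto_mult_right_zero) (auto simp: cauchy_equiv_iff)
  ultimately show "(c \<odot>\<^bsub>cauchy_module V\<^esub> s, c \<odot>\<^bsub>cauchy_module V\<^esub> t) \<in> cauchy_equiv V"
    using st by (auto simp: cauchy_equiv_iff cauchy_seqs_scale)
qed (simp_all add: completion_def)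

abbreviation cauchy_class where "cauchy_class s \<equiv> cauchy_equiv V `` {s}"

lemmas completion_class_closed = quotient_module.class_closed[OF quotient_module_completion, simplified]
lemmas completion_class_cases = quotient_module.class_cases[OF quotient_module_completion, simplified]
lemmas completion_class_add = quotient_module.class_add[OF quotient_module_completion, simplified]
lemmas completion_class_scale = quotient_module.class_scale[OF quotient_module_completion, simplified]
lemmas completion_in_class_self = quotient_module.in_class_self[OF quotient_module_completion, simplified]
lemmas completion_zero = quotient_module.zero_Q[OF quotient_module_completion, simplified]
lemmas completion_class_eq_iff = quotient_module.class_eq_iff[OF quotient_module_completion, simplified]

lemma completion_class_diff:
  assumes "s \<in> cauchy_seqs V" "t \<in> cauchy_seqs V"
  shows "cauchy_class s \<ominus>\<^bsub>completion V\<^esub> cauchy_class t = cauchy_class (\<lambda>n. s n \<ominus> t n)"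
    and "(\<lambda>n. s n \<ominus> t n) \<in> cauchy_seqs V"
proof -
  have eq: "(\<lambda>n. s n \<ominus> t n) = s \<ominus>\<^bsub>cauchy_module V\<^esub> t"
    using assms
    by (auto simp: scalar_module.diff_eq_scale[OF scalar_module_cauchy] diff_eq_scale cauchy_seqs_carrier)
  show "cauchy_class s \<ominus>\<^bsub>completion V\<^esub> cauchy_class t = cauchy_class (\<lambda>n. s n \<ominus> t n)"
    using quotient_module.class_diff[OF quotient_module_completion, of s t] assms
    by (simp add: eq)
  show "(\<lambda>n. s n \<ominus> t n) \<in> cauchy_seqs V"
    using scalar_module.diff_closed[OF scalar_module_cauchy, of s t] assms by (simp add: eq)
qed

text \<open>Justifies the \<open>THE\<close> in \<open>completion\<close>: the seminorms along a
  Cauchy sequence form a real Cauchy sequence, and the reverse triangle inequality gives equivalent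
  sequences the same limit. Norms in the completion can thus be computed along any
  representative.\<close>

lemma tendsto_nrm_completion:
  assumes s: "s \<in> cauchy_seqs V"
  shows "(\<lambda>n. nrm V (s n)) \<longlonglongrightarrow> nrm (completion V) (cauchy_class s)"
proof -
  obtain r where r: "(\<lambda>n. nrm V (s n)) \<longlonglongrightarrow> r"
    using convergent_seminorm_cauchy_seq[OF s] by (auto simp: convergent_def)
  have "nrm (completion V) (cauchy_class s) = (THE r. \<exists>t\<in>cauchy_class s. (\<lambda>n. nrm V (t n)) \<longlonglongrightarrow> r)"
    by (simp add: completion_def)
  also have "\<dots> = r"
  proof (rule the_equality)
    show "\<exists>t\<in>cauchy_class s. (\<lambda>n. nrm V (t n)) \<longlonglongrightarrow> r"
      using r completion_in_class_self[OF s] by blast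
    fix r' assume "\<exists>t\<in>cauchy_class s. (\<lambda>n. nrm V (t n)) \<longlonglongrightarrow> r'"
    then obtain t where t: "(s, t) \<in> cauchy_equiv V" and r': "(\<lambda>n. nrm V (t n)) \<longlonglongrightarrow> r'"
      by auto
    have "(\<lambda>n. \<bar>nrm V (s n) - nrm V (t n)\<bar>) \<longlonglongrightarrow> 0"
    proof (rule tendsto_zero_dominated)
      show "(\<lambda>n. nrm V (s n \<ominus> t n)) \<longlonglongrightarrow> 0" using t by (simp add: cauchy_equiv_iff)
      show "\<bar>nrm V (s n) - nrm V (t n)\<bar> \<le> nrm V (s n \<ominus> t n)" for n
        using t by (intro seminorm_reverse_triangle) (auto simp: cauchy_equiv_iff cauchy_seqs_carrier)
    qed simp
    then have "(\<lambda>n. nrm V (s n) - nrm V (t n)) \<longlonglongrightarrow> 0"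
      by (rule tendsto_rabs_zero_cancel)
    from LIMSEQ_unique[OF tendsto_diff[OF r r'] this] show "r' = r" by simp
  qed
  finally show ?thesis using r by simp
qed

lemma nrm_completion_le:
  assumes "s \<in> cauchy_seqs V" and "\<And>n. n \<ge> N \<Longrightarrow> nrm V (s n) \<le> b"
  shows "nrm (completion V) (cauchy_class s) \<le> b"
  by (rule LIMSEQ_le_const2[OF tendsto_nrm_completion]) (use assms in auto)

lemma nrm_completion_const: "x \<in> carrier V \<Longrightarrow> nrm (completion V) (cauchy_class (\<lambda>_. x)) = nrm V x"
  using tendsto_nrm_completion[OF cauchy_seqs_const, of x]
  by (simp add: LIMSEQ_const_iff)

lemma normed_space_completion: "normed_space (completion V)"
proof -
  interpret C: scalar_module "completion V"
    by (rule quotient_module.scalar_module_Q[OF quotient_module_completion])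
  show ?thesis
  proof
    fix A assume "A \<in> carrier (completion V)"
    then obtain s where s: "s \<in> cauchy_seqs V" and A: "A = cauchy_class s"
      by (rule completion_class_cases)
    show "0 \<le> nrm (completion V) A"
      unfolding A by (rule LIMSEQ_le_const[OF tendsto_nrm_completion[OF s]])
        (use s in \<open>auto simp: seminorm_nonneg cauchy_seqs_carrier\<close>)
    \<comment> \<open>This is where a seminorm becomes a norm: norm zero says that a representative
      is a null sequence, hence equivalent to the constant zero sequence.\<close>
    show "nrm (completion V) A = 0 \<longleftrightarrow> A = \<zero>\<^bsub>completion V\<^esub>"
    proof
      assume "nrm (completion V) A = 0"
      then have "(\<lambda>n. nrm V (s n)) \<longlonglongrightarrow> 0"
        using tendsto_nrm_completion[OF s] A by simp
      then show "A = \<zero>\<^bsub>completion V\<^esub>"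
        using s by (simp add: A completion_zero completion_class_eq_iff cauchy_seqs_const
            cauchy_equiv_iff diff_zero cauchy_seqs_carrier)
    next
      assume "A = \<zero>\<^bsub>completion V\<^esub>"
      then show "nrm (completion V) A = 0"
        by (simp add: completion_zero nrm_completion_const)
    qed
    show "nrm (completion V) (c \<odot>\<^bsub>completion V\<^esub> A) = norm c * nrm (completion V) A" for c
    proof (rule LIMSEQ_unique)
      show "(\<lambda>n. nrm V (c \<odot> s n)) \<longlonglongrightarrow> nrm (completion V) (c \<odot>\<^bsub>completion V\<^esub> A)"
        using tendsto_nrm_completion[OF cauchy_seqs_scale[OF s]] s by (simp add: A completion_class_scale)
      show "(\<lambda>n. nrm V (c \<odot> s n)) \<longlonglongrightarrow> norm c * nrm (completion V) A"
        using tendsto_mult_left[OF tendsto_nrm_completion[OF s], of "norm c"] s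
        by (simp add: A seminorm_scale cauchy_seqs_carrier)
    qed
    fix B assume "B \<in> carrier (completion V)"
    then obtain t where t: "t \<in> cauchy_seqs V" and B: "B = cauchy_class t"
      by (rule completion_class_cases)
    show "nrm (completion V) (A \<oplus>\<^bsub>completion V\<^esub> B) \<le> nrm (completion V) A + nrm (completion V) B"
    proof (rule LIMSEQ_le)
      show "(\<lambda>n. nrm V (s n \<oplus> t n)) \<longlonglongrightarrow> nrm (completion V) (A \<oplus>\<^bsub>completion V\<^esub> B)"
        using tendsto_nrm_completion[OF cauchy_seqs_add[OF s t]] s t
        by (simp add: A B completion_class_add)
      show "(\<lambda>n. nrm V (s n) + nrm V (t n)) \<longlonglongrightarrow> nrm (completion V) A + nrm (completion V) B"
        unfolding A B by (intro tendsto_add tendsto_nrm_completion s t)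
    qed (use s t in \<open>auto simp: seminorm_triangle cauchy_seqs_carrier\<close>)
  qed
qed

end

section \<open>Norm topology and completeness in terms of the norm\<close>

context normed_space
begin

lemma norm_metric_simps [simp]:
  "mspace (norm_metric V) = carrier V" "mdist (norm_metric V) = norm_dist V"
  by (simp_all add: norm_metric_def Metric_space.mspace_metric[OF Metric_space_norm_dist]
      Metric_space.mdist_metric[OF Metric_space_norm_dist])

lemma norm_dist_eq: "x \<in> carrier V \<Longrightarrow> y \<in> carrier V \<Longrightarrow> norm_dist V x y = nrm V (x \<ominus> y)"
  by (simp add: norm_dist_def)

lemma norm_topology_eq: "norm_topology V = Metric_space.mtopology (carrier V) (norm_dist V)"
  by (simp add: norm_topology_def mtopology_of_def)

lemma topspace_norm_topology [simp]: "topspace (norm_topology V) = carrier V"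
  by (simp add: norm_topology_eq Metric_space.topspace_mtopology[OF Metric_space_norm_dist])

lemma limitin_norm_topology_iff:
  assumes x: "\<And>n. x n \<in> carrier V"
  shows "limitin (norm_topology V) x l sequentially \<longleftrightarrow>
    l \<in> carrier V \<and> (\<lambda>n. nrm V (x n \<ominus> l)) \<longlonglongrightarrow> 0"
  using x by (auto simp: norm_topology_eq norm_dist_eq cong: conj_cong
      Metric_space.limitin_metric_dist_null[OF Metric_space_norm_dist])

lemma MCauchy_iff: "Metric_space.MCauchy (carrier V) (norm_dist V) s \<longleftrightarrow> s \<in> cauchy_seqs V"
proof -
  have "(\<forall>e>0. \<exists>N. \<forall>n n'. N \<le> n \<longrightarrow> N \<le> n' \<longrightarrow> norm_dist V (s n) (s n') < e) \<longleftrightarrow>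
    (\<forall>e>0. \<exists>N. \<forall>n\<ge>N. \<forall>n'\<ge>N. nrm V (s n \<ominus> s n') < e)" if "\<And>n. s n \<in> carrier V"
    by (simp add: norm_dist_eq that)
  then show ?thesis
    unfolding Metric_space.MCauchy_def[OF Metric_space_norm_dist] cauchy_seqs_def
      image_subset_iff mem_Collect_eq by auto
qed

lemma banach_space_iff:
  "banach_space V \<longleftrightarrow>
    (\<forall>s\<in>cauchy_seqs V. \<exists>l\<in>carrier V. (\<lambda>n. nrm V (s n \<ominus> l)) \<longlonglongrightarrow> 0)"
proof -
  have "banach_space V \<longleftrightarrow> Metric_space.mcomplete (carrier V) (norm_dist V)"
    by (simp add: banach_space_def banach_space_axioms_def normed_space_axioms mcomplete_of_def)
  also have "\<dots> \<longleftrightarrow> (\<forall>s\<in>cauchy_seqs V. \<exists>l. limitin (norm_topology V) s l sequentially)"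
    by (auto simp: Metric_space.mcomplete_def[OF Metric_space_norm_dist] MCauchy_iff norm_topology_eq)
  also have "\<dots> \<longleftrightarrow> (\<forall>s\<in>cauchy_seqs V. \<exists>l\<in>carrier V. (\<lambda>n. nrm V (s n \<ominus> l)) \<longlonglongrightarrow> 0)"
    by (intro ball_cong refl) (auto simp: limitin_norm_topology_iff cauchy_seqs_carrier)
  finally show ?thesis .
qed

end

text \<open>Diagonal argument: each class \<open>A k\<close> is approximated by the constant class
  of one term of a representative. These terms form a Cauchy sequence in \<open>V\<close>, and its
  class is the limit of \<open>A\<close>.\<close>

theorem (in seminormed_space) banach_space_completion: "banach_space (completion V)"
proof -
  interpret C: normed_space "completion V" by (rule normed_space_completion)
  have "\<exists>L\<in>carrier (completion V). (\<lambda>k. nrm (completion V) (A k \<ominus>\<^bsub>completion V\<^esub> L)) \<longlonglongrightarrow> 0"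
    if A: "A \<in> cauchy_seqs (completion V)" for A
  proof -
    have "\<exists>s. s \<in> cauchy_seqs V \<and> A k = cauchy_class s" for k
      using C.cauchy_seqs_carrier[OF A, of k] by (rule completion_class_cases) blast
    then obtain s where s: "\<And>k. s k \<in> cauchy_seqs V" and As: "\<And>k. A k = cauchy_class (s k)"
      by metis
    have "\<exists>N. \<forall>n\<ge>N. \<forall>n'\<ge>N. nrm V (s k n \<ominus> s k n') < inverse (Suc k)" for k
      by (rule cauchy_seqsD[OF s]) simp
    then obtain N where N: "\<And>k n n'. n \<ge> N k \<Longrightarrow> n' \<ge> N k \<Longrightarrow> nrm V (s k n \<ominus> s k n') < inverse (Suc k)"
      by metis
    \<comment> \<open>Beyond \<open>N k\<close> the representative of \<open>A k\<close> oscillates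
      by less than \<open>1 / (k + 1)\<close>, so the constant class of its term at
      \<open>N k\<close> is that close to \<open>A k\<close>.\<close>
    define t where "t k = s k (N k)" for k
    have t_car: "t k \<in> carrier V" for k
      using s by (simp add: t_def cauchy_seqs_carrier)
    have near: "nrm (completion V) (A k \<ominus>\<^bsub>completion V\<^esub> cauchy_class (\<lambda>_. t k)) \<le> inverse (Suc k)" for k
      unfolding As using s t_car
      by (subst completion_class_diff)
        (auto intro!: nrm_completion_le[of _ "N k"] completion_class_diff(2) cauchy_seqs_const
          less_imp_le[OF N] simp: t_def simp del: of_nat_Suc)
    have ccl: "A k \<in> carrier (completion V)" "cauchy_class (\<lambda>_. t k) \<in> carrier (completion V)" for k
      using As s t_car by (auto simp: completion_class_closed cauchy_seqs_const)
    have t: "t \<in> cauchy_seqs V"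
      unfolding cauchy_seqs_def
    proof (intro CollectI conjI allI impI)
      show "range t \<subseteq> carrier V" using t_car by auto
      fix e :: real assume e: "0 < e"
      then have "0 < e / 3" by simp
      from C.cauchy_seqsD[OF A this] obtain M where M: "\<And>k l. k \<ge> M \<Longrightarrow> l \<ge> M \<Longrightarrow>
        nrm (completion V) (A k \<ominus>\<^bsub>completion V\<^esub> A l) < e / 3" by blast
      obtain K where K: "inverse (real (Suc K)) < e / 3"
        using reals_Archimedean[OF \<open>0 < e / 3\<close>] by blast
      have K': "inverse (real (Suc k)) < e / 3" if "k \<ge> K" for k
        using that by (intro le_less_trans[OF _ K]) (simp add: field_simps)
      show "\<exists>N. \<forall>k\<ge>N. \<forall>l\<ge>N. nrm V (t k \<ominus> t l) < e"
      proof (intro exI allI impI)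
        fix k l assume kl: "max M K \<le> k" "max M K \<le> l"
        let ?C = "completion V"
        have "nrm V (t k \<ominus> t l) = nrm ?C (cauchy_class (\<lambda>_. t k) \<ominus>\<^bsub>?C\<^esub> cauchy_class (\<lambda>_. t l))"
          using t_car by (simp add: completion_class_diff cauchy_seqs_const nrm_completion_const)
        also have "\<dots> \<le> nrm ?C (cauchy_class (\<lambda>_. t k) \<ominus>\<^bsub>?C\<^esub> A k) + nrm ?C (A k \<ominus>\<^bsub>?C\<^esub> cauchy_class (\<lambda>_. t l))"
          by (intro C.seminorm_diff_triangle ccl)
        also have "\<dots> \<le> nrm ?C (cauchy_class (\<lambda>_. t k) \<ominus>\<^bsub>?C\<^esub> A k) + (nrm ?C (A k \<ominus>\<^bsub>?C\<^esub> A l)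
          + nrm ?C (A l \<ominus>\<^bsub>?C\<^esub> cauchy_class (\<lambda>_. t l)))"
          by (intro add_left_mono C.seminorm_diff_triangle ccl)
        also have "nrm ?C (cauchy_class (\<lambda>_. t k) \<ominus>\<^bsub>?C\<^esub> A k) = nrm ?C (A k \<ominus>\<^bsub>?C\<^esub> cauchy_class (\<lambda>_. t k))"
          by (intro C.seminorm_diff_commute ccl)
        also have "\<dots> + (nrm ?C (A k \<ominus>\<^bsub>?C\<^esub> A l) + nrm ?C (A l \<ominus>\<^bsub>?C\<^esub> cauchy_class (\<lambda>_. t l))) < e"
          using near[of k] near[of l] K'[of k] K'[of l] M[of k l] kl by simp
        finally show "nrm V (t k \<ominus> t l) < e" .
      qed
    qed
    \<comment> \<open>Density of \<open>V\<close> in its completion: the class of a Cauchy sequence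
      is the limit of the constant classes of its terms.\<close>
    have "(\<lambda>k. nrm (completion V) (cauchy_class (\<lambda>_. t k) \<ominus>\<^bsub>completion V\<^esub> cauchy_class t)) \<longlonglongrightarrow> 0"
    proof (rule LIMSEQ_I)
      fix e :: real assume "0 < e"
      then have "0 < e / 2" by simp
      from cauchy_seqsD[OF t this] obtain M where
        M: "\<And>k l. k \<ge> M \<Longrightarrow> l \<ge> M \<Longrightarrow> nrm V (t k \<ominus> t l) < e / 2" by blast
      show "\<exists>no. \<forall>k\<ge>no. norm (nrm (completion V) (cauchy_class (\<lambda>_. t k) \<ominus>\<^bsub>completion V\<^esub> cauchy_class t) - 0) < e"
      proof (intro exI allI impI)
        fix k assume "M \<le> k"
        then have "nrm (completion V) (cauchy_class (\<lambda>n. t k \<ominus> t n)) \<le> e / 2"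
          using t_car t by (intro nrm_completion_le[of _ M] completion_class_diff(2) cauchy_seqs_const
              less_imp_le[OF M]) auto
        then have "nrm (completion V) (cauchy_class (\<lambda>_. t k) \<ominus>\<^bsub>completion V\<^esub> cauchy_class t) \<le> e / 2"
          using t_car t by (simp add: completion_class_diff cauchy_seqs_const)
        moreover have "0 \<le> nrm (completion V) (cauchy_class (\<lambda>_. t k) \<ominus>\<^bsub>completion V\<^esub> cauchy_class t)"
          using t by (intro C.nrm_nonneg C.diff_closed ccl completion_class_closed)
        ultimately show "norm (nrm (completion V) (cauchy_class (\<lambda>_. t k) \<ominus>\<^bsub>completion V\<^esub> cauchy_class t) - 0) < e"
          using \<open>0 < e\<close> by simp
      qed
    qed
    then have *: "(\<lambda>k. inverse (real (Suc k))
        + nrm (completion V) (cauchy_class (\<lambda>_. t k) \<ominus>\<^bsub>completion V\<^esub> cauchy_class t)) \<longlonglongrightarrow> 0"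
      by (intro tendsto_add_zero LIMSEQ_inverse_real_of_nat)
    have "(\<lambda>k. nrm (completion V) (A k \<ominus>\<^bsub>completion V\<^esub> cauchy_class t)) \<longlonglongrightarrow> 0"
    proof (rule tendsto_zero_dominated[OF *])
      fix k
      show "0 \<le> nrm (completion V) (A k \<ominus>\<^bsub>completion V\<^esub> cauchy_class t)"
        using t by (intro C.nrm_nonneg C.diff_closed ccl completion_class_closed)
      show "nrm (completion V) (A k \<ominus>\<^bsub>completion V\<^esub> cauchy_class t) \<le> inverse (real (Suc k))
        + nrm (completion V) (cauchy_class (\<lambda>_. t k) \<ominus>\<^bsub>completion V\<^esub> cauchy_class t)"
        using C.seminorm_diff_triangle[OF ccl(1) ccl(2) completion_class_closed[OF t], of k k] near[of k]
        by simp
    qed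
    then show ?thesis using completion_class_closed[OF t] by blast
  qed
  then show ?thesis by (simp add: C.banach_space_iff)
qed

section \<open>Bounded linear maps\<close>

text \<open>Membership in the carrier is part of the notion because \<open>nrm\<close> is arbitrary
  outside it. Limits become unique only in \<open>normed_space\<close>.\<close>

definition (in seminormed_space) norm_tendsto :: "(nat \<Rightarrow> 'a) \<Rightarrow> 'a \<Rightarrow> bool" where
  "norm_tendsto x l \<longleftrightarrow>
     (\<forall>n. x n \<in> carrier V) \<and> l \<in> carrier V \<and> (\<lambda>n. nrm V (x n \<ominus> l)) \<longlonglongrightarrow> 0"

context seminormed_space
begin

lemma norm_tendsto_add:
  assumes x: "norm_tendsto x a" and y: "norm_tendsto y b"
  shows "norm_tendsto (\<lambda>n. x n \<oplus> y n) (a \<oplus> b)"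
proof -
  have "(\<lambda>n. nrm V (x n \<oplus> y n \<ominus> (a \<oplus> b))) \<longlonglongrightarrow> 0"
  proof (rule tendsto_zero_dominated)
    show "(\<lambda>n. nrm V (x n \<ominus> a) + nrm V (y n \<ominus> b)) \<longlonglongrightarrow> 0"
      using x y by (intro tendsto_add_zero) (auto simp: norm_tendsto_def)
  qed (use x y in \<open>auto simp: norm_tendsto_def intro!: seminorm_nonneg seminorm_add_diff\<close>)
  then show ?thesis using x y by (simp add: norm_tendsto_def)
qed

lemma norm_tendsto_scale:
  assumes x: "norm_tendsto x a"
  shows "norm_tendsto (\<lambda>n. c \<odot> x n) (c \<odot> a)"
  using x tendsto_mult_right_zero[of "\<lambda>n. nrm V (x n \<ominus> a)" sequentially "norm c"]
  by (simp add: norm_tendsto_def seminorm_scale_diff)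

lemma tendsto_nrm:
  assumes x: "norm_tendsto x a"
  shows "(\<lambda>n. nrm V (x n)) \<longlonglongrightarrow> nrm V a"
proof -
  have "(\<lambda>n. \<bar>nrm V (x n) - nrm V a\<bar>) \<longlonglongrightarrow> 0"
    by (rule tendsto_zero_dominated[of "\<lambda>n. nrm V (x n \<ominus> a)"])
      (use x in \<open>auto simp: norm_tendsto_def seminorm_reverse_triangle\<close>)
  then show ?thesis
    by (simp add: LIM_zero_iff tendsto_rabs_zero_iff)
qed

lemma norm_tendsto_const: "x \<in> carrier V \<Longrightarrow> norm_tendsto (\<lambda>_. x) x"
  by (simp add: norm_tendsto_def diff_self)

lemma norm_tendsto_close:
  assumes x: "norm_tendsto x a" and y: "\<And>n. y n \<in> carrier V"
    and xy: "(\<lambda>n. nrm V (y n \<ominus> x n)) \<longlonglongrightarrow> 0"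
  shows "norm_tendsto y a"
proof -
  have "(\<lambda>n. nrm V (y n \<ominus> a)) \<longlonglongrightarrow> 0"
  proof (rule tendsto_zero_dominated)
    show "(\<lambda>n. nrm V (y n \<ominus> x n) + nrm V (x n \<ominus> a)) \<longlonglongrightarrow> 0"
      using x xy by (intro tendsto_add_zero) (auto simp: norm_tendsto_def)
  qed (use x y in \<open>auto simp: norm_tendsto_def intro!: seminorm_nonneg seminorm_diff_triangle\<close>)
  then show ?thesis using x y by (simp add: norm_tendsto_def)
qed

end

lemma (in banach_space) cauchy_seqs_limit:
  assumes "s \<in> cauchy_seqs V"
  obtains l where "l \<in> carrier V" "(\<lambda>n. nrm V (s n \<ominus> l)) \<longlonglongrightarrow> 0"
proof -
  have "\<exists>l\<in>carrier V. (\<lambda>n. nrm V (s n \<ominus> l)) \<longlonglongrightarrow> 0"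
    using banach_space_axioms unfolding banach_space_iff by (rule bspec) (rule assms)
  then show ?thesis using that by blast
qed

lemma (in normed_space) norm_tendsto_unique:
  assumes x: "norm_tendsto x a" and y: "norm_tendsto x b"
  shows "a = b"
proof -
  have "(\<lambda>n. nrm V (a \<ominus> b)) \<longlonglongrightarrow> 0"
  proof (rule tendsto_zero_dominated)
    show "(\<lambda>n. nrm V (x n \<ominus> a) + nrm V (x n \<ominus> b)) \<longlonglongrightarrow> 0"
      using x y by (intro tendsto_add_zero) (auto simp: norm_tendsto_def)
    show "nrm V (a \<ominus> b) \<le> nrm V (x n \<ominus> a) + nrm V (x n \<ominus> b)" for n
      using seminorm_diff_triangle[of a "x n" b] seminorm_diff_commute[of a "x n"] x y
      by (simp add: norm_tendsto_def)
  qed (use x y in \<open>auto simp: norm_tendsto_def intro!: nrm_nonneg\<close>)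
  then have "a \<ominus> b = \<zero>"
    using x y by (simp add: LIMSEQ_const_iff nrm_eq_0_iff norm_tendsto_def)
  then show "a = b"
    using diff_add[of a b] x y by (simp add: norm_tendsto_def)
qed

lemma lin_mapD:
  assumes "lin_map V W u"
  shows "x \<in> carrier V \<Longrightarrow> u x \<in> carrier W"
    and "x \<in> carrier V \<Longrightarrow> y \<in> carrier V \<Longrightarrow> u (x \<oplus>\<^bsub>V\<^esub> y) = u x \<oplus>\<^bsub>W\<^esub> u y"
    and "x \<in> carrier V \<Longrightarrow> u (c \<odot>\<^bsub>V\<^esub> x) = c \<odot>\<^bsub>W\<^esub> u x"
  using assms by (auto simp: lin_map_def)

lemma lin_map_diff:
  assumes "scalar_module V" "scalar_module W" "lin_map V W u" "x \<in> carrier V" "y \<in> carrier V"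
  shows "u (x \<ominus>\<^bsub>V\<^esub> y) = u x \<ominus>\<^bsub>W\<^esub> u y"
proof -
  interpret V: scalar_module V by fact
  interpret W: scalar_module W by fact
  show ?thesis
    using assms by (simp add: V.diff_eq_scale W.diff_eq_scale lin_mapD)
qed

lemma (in seminormed_space) lin_map_cauchy_seqs:
  assumes "seminormed_space W" and u: "lin_map V W u"
    and bound: "\<And>x. x \<in> carrier V \<Longrightarrow> nrm W (u x) \<le> C * nrm V x"
    and s: "s \<in> cauchy_seqs V"
  shows "(\<lambda>n. u (s n)) \<in> cauchy_seqs W"
  unfolding cauchy_seqs_def
proof (intro CollectI conjI allI impI)
  interpret W: seminormed_space W by fact
  show "range (\<lambda>n. u (s n)) \<subseteq> carrier W"
    using s u by (auto simp: cauchy_seqs_carrier lin_mapD)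
  fix e :: real assume e: "0 < e"
  \<comment> \<open>The sign of \<open>C\<close> is unrestricted, hence the absolute value; the
    summand 1 covers \<open>C = 0\<close>.\<close>
  then have "0 < e / (\<bar>C\<bar> + 1)" by (simp add: add_nonneg_pos)
  from cauchy_seqsD[OF s this] obtain N
    where N: "\<And>n n'. n \<ge> N \<Longrightarrow> n' \<ge> N \<Longrightarrow> nrm V (s n \<ominus> s n') < e / (\<bar>C\<bar> + 1)" by blast
  show "\<exists>N. \<forall>n\<ge>N. \<forall>n'\<ge>N. nrm W (u (s n) \<ominus>\<^bsub>W\<^esub> u (s n')) < e"
  proof (intro exI allI impI)
    fix n n' assume n: "N \<le> n" "N \<le> n'"
    have car: "s n \<in> carrier V" "s n' \<in> carrier V" using s by (auto simp: cauchy_seqs_carrier)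
    then have "nrm W (u (s n) \<ominus>\<^bsub>W\<^esub> u (s n')) \<le> C * nrm V (s n \<ominus> s n')"
      using bound[of "s n \<ominus> s n'"] lin_map_diff[OF scalar_module_axioms W.scalar_module_axioms u car]
      by simp
    also have "\<dots> \<le> (\<bar>C\<bar> + 1) * nrm V (s n \<ominus> s n')"
      using car by (intro mult_right_mono seminorm_nonneg) auto
    also have "\<dots> < e"
      using N[OF n] by (simp add: pos_less_divide_eq add_nonneg_pos mult.commute)
    finally show "nrm W (u (s n) \<ominus>\<^bsub>W\<^esub> u (s n')) < e" .
  qed
qed

text \<open>A bounded linear map preserves Cauchy sequences, and a complete target supplies limits
  for their images. Linearity of the extension follows from uniqueness of limits, and the bound with
  the same \<open>C\<close> by passing to the limit along a representative.\<close>

lemma (in seminormed_space) lin_map_extend_completion: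
  assumes "banach_space W" and u: "lin_map V W u"
    and bound: "\<And>x. x \<in> carrier V \<Longrightarrow> nrm W (u x) \<le> C * nrm V x"
  shows "\<exists>v. lin_map (completion V) W v \<and>
    (\<forall>A\<in>carrier (completion V). nrm W (v A) \<le> C * nrm (completion V) A) \<and>
    (\<forall>x\<in>carrier V. v (cauchy_class (\<lambda>_. x)) = u x)"
proof -
  interpret W: banach_space W by fact
  \<comment> \<open>One limit is demanded for all representatives at once, so that the chosen
    \<open>v\<close> can later be evaluated along whichever representative is convenient.\<close>
  have "\<exists>l. \<forall>s\<in>A. W.norm_tendsto (\<lambda>n. u (s n)) l" if "A \<in> carrier (completion V)" for A
  proof -
    from that obtain s where s: "s \<in> cauchy_seqs V" and A: "A = cauchy_class s"
      by (rule completion_class_cases)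
    obtain l where l: "l \<in> carrier W" "(\<lambda>n. nrm W (u (s n) \<ominus>\<^bsub>W\<^esub> l)) \<longlonglongrightarrow> 0"
      by (rule W.cauchy_seqs_limit[OF
            lin_map_cauchy_seqs[OF W.seminormed_space_axioms u bound s]])
    then have l': "W.norm_tendsto (\<lambda>n. u (s n)) l"
      using s u by (simp add: W.norm_tendsto_def cauchy_seqs_carrier lin_mapD)
    have "W.norm_tendsto (\<lambda>n. u (t n)) l" if "t \<in> A" for t
    proof (rule W.norm_tendsto_close[OF l'])
      have st: "s \<in> cauchy_seqs V" "t \<in> cauchy_seqs V" "(\<lambda>n. nrm V (s n \<ominus> t n)) \<longlonglongrightarrow> 0"
        using that by (auto simp: A cauchy_equiv_iff)
      then have car: "s n \<in> carrier V" "t n \<in> carrier V" for n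
        by (auto simp: cauchy_seqs_carrier)
      show "u (t n) \<in> carrier W" for n using car u by (simp add: lin_mapD)
      have ut: "u (t n) \<ominus>\<^bsub>W\<^esub> u (s n) = u (t n \<ominus> s n)" for n
        using car lin_map_diff[OF scalar_module_axioms W.scalar_module_axioms u] by simp
      show "(\<lambda>n. nrm W (u (t n) \<ominus>\<^bsub>W\<^esub> u (s n))) \<longlonglongrightarrow> 0"
        unfolding ut
      proof (rule tendsto_zero_dominated)
        show "(\<lambda>n. C * nrm V (s n \<ominus> t n)) \<longlonglongrightarrow> 0"
          using st by (intro tendsto_mult_right_zero)
        show "nrm W (u (t n \<ominus> s n)) \<le> C * nrm V (s n \<ominus> t n)" for n
          using bound[of "t n \<ominus> s n"] car by (simp add: seminorm_diff_commute)
        show "0 \<le> nrm W (u (t n \<ominus> s n))" for n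
          using car u by (intro W.nrm_nonneg) (simp add: lin_mapD)
      qed
    qed
    then show ?thesis by blast
  qed
  then obtain v where v: "\<And>A s. A \<in> carrier (completion V) \<Longrightarrow> s \<in> A \<Longrightarrow>
      W.norm_tendsto (\<lambda>n. u (s n)) (v A)"
    by metis
  have vs: "W.norm_tendsto (\<lambda>n. u (s n)) (v (cauchy_class s))" if "s \<in> cauchy_seqs V" for s
    by (rule v[OF completion_class_closed[OF that]]) (simp add: completion_in_class_self[OF that])
  show ?thesis
  proof (intro exI[of _ v] conjI ballI)
    show "lin_map (completion V) W v"
      unfolding lin_map_def
    proof (intro conjI ballI allI funcsetI)
      fix A assume "A \<in> carrier (completion V)"
      then obtain s where s: "s \<in> cauchy_seqs V" and A: "A = cauchy_class s"
        by (rule completion_class_cases)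
      show "v A \<in> carrier W"
        using vs[OF s] by (simp add: W.norm_tendsto_def A)
      show "v (c \<odot>\<^bsub>completion V\<^esub> A) = c \<odot>\<^bsub>W\<^esub> v A" for c
        unfolding A completion_class_scale[OF s]
      proof (rule W.norm_tendsto_unique)
        show "W.norm_tendsto (\<lambda>n. u (c \<odot> s n)) (v (cauchy_class (\<lambda>n. c \<odot> s n)))"
          by (rule vs[OF cauchy_seqs_scale[OF s]])
        show "W.norm_tendsto (\<lambda>n. u (c \<odot> s n)) (c \<odot>\<^bsub>W\<^esub> v (cauchy_class s))"
          using W.norm_tendsto_scale[OF vs[OF s]] s u by (simp add: lin_mapD cauchy_seqs_carrier)
      qed
      fix B assume "B \<in> carrier (completion V)"
      then obtain t where t: "t \<in> cauchy_seqs V" and B: "B = cauchy_class t"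
        by (rule completion_class_cases)
      show "v (A \<oplus>\<^bsub>completion V\<^esub> B) = v A \<oplus>\<^bsub>W\<^esub> v B"
        unfolding A B completion_class_add[OF s t]
      proof (rule W.norm_tendsto_unique)
        show "W.norm_tendsto (\<lambda>n. u (s n \<oplus> t n)) (v (cauchy_class (\<lambda>n. s n \<oplus> t n)))"
          by (rule vs[OF cauchy_seqs_add[OF s t]])
        show "W.norm_tendsto (\<lambda>n. u (s n \<oplus> t n)) (v (cauchy_class s) \<oplus>\<^bsub>W\<^esub> v (cauchy_class t))"
          using W.norm_tendsto_add[OF vs[OF s] vs[OF t]] s t u
          by (simp add: lin_mapD cauchy_seqs_carrier)
      qed
    qed
    show "nrm W (v A) \<le> C * nrm (completion V) A" if "A \<in> carrier (completion V)" for A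
    proof -
      from that obtain s where s: "s \<in> cauchy_seqs V" and A: "A = cauchy_class s"
        by (rule completion_class_cases)
      show ?thesis unfolding A
        by (rule LIMSEQ_le[OF W.tendsto_nrm[OF vs[OF s]]
              tendsto_mult_left[OF tendsto_nrm_completion[OF s]]])
          (use s in \<open>auto simp: bound cauchy_seqs_carrier\<close>)
    qed
    show "v (cauchy_class (\<lambda>_. x)) = u x" if "x \<in> carrier V" for x
      using that u by (intro W.norm_tendsto_unique[OF vs W.norm_tendsto_const])
        (auto simp: cauchy_seqs_const lin_mapD)
  qed
qed

lemma continuous_map_bounded_lin_map:
  assumes "normed_space V" "normed_space W" and u: "lin_map V W u"
    and bound: "\<And>x. x \<in> carrier V \<Longrightarrow> nrm W (u x) \<le> C * nrm V x"
  shows "continuous_map (norm_topology V) (norm_topology W) u"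
proof -
  interpret V: normed_space V by fact
  interpret W: normed_space W by fact
  have "Lipschitz_continuous_map (norm_metric V) (norm_metric W) u"
    unfolding Lipschitz_continuous_map_def
  proof (intro conjI exI ballI)
    show "u \<in> mspace (norm_metric V) \<rightarrow> mspace (norm_metric W)"
      using u by (auto simp: lin_mapD)
    fix x y assume "x \<in> mspace (norm_metric V)" "y \<in> mspace (norm_metric V)"
    then show "mdist (norm_metric W) (u x) (u y) \<le> C * mdist (norm_metric V) x y"
      using bound[of "x \<ominus>\<^bsub>V\<^esub> y"] u
        lin_map_diff[OF V.scalar_module_axioms W.scalar_module_axioms u, of x y]
      by (simp add: V.norm_dist_eq W.norm_dist_eq lin_mapD)
  qed
  then show ?thesis
    unfolding norm_topology_def by (rule Lipschitz_continuous_imp_continuous_map)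
qed

section \<open>Schur property and uniform boundedness\<close>

text \<open>Interlacing the sequence with its weak limit identifies the norm limit without a separation
  theorem for the dual.\<close>

lemma schur_norm_tendsto:
  assumes "normed_space V" "schur_property V" and x: "weakly_converges V x a"
  shows "seminormed_space.norm_tendsto V x a"
proof -
  interpret V: normed_space V by fact
  have car: "x n \<in> carrier V" "a \<in> carrier V" for n
    using x by (auto simp: weakly_converges_def)
  define y where "y n = (if even n then x (n div 2) else a)" for n
  have ycar: "y n \<in> carrier V" for n using car by (simp add: y_def)
  have "weakly_converges V y a"
    unfolding weakly_converges_def
  proof (intro conjI ballI)
    fix f assume "f \<in> dual V"
    then have f: "(\<lambda>n. f (x n)) \<longlonglongrightarrow> f a" using x by (simp add: weakly_converges_def)
    show "(\<lambda>n. f (y n)) \<longlonglongrightarrow> f a"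
    proof (rule LIMSEQ_I)
      fix e :: real assume e: "0 < e"
      from LIMSEQ_D[OF f this] obtain N where N: "\<And>n. n \<ge> N \<Longrightarrow> norm (f (x n) - f a) < e" by blast
      show "\<exists>no. \<forall>n\<ge>no. norm (f (y n) - f a) < e"
        by (rule exI[of _ "2 * N"]) (use e in \<open>auto simp: y_def intro!: N\<close>)
    qed
  qed (use ycar car in auto)
  then obtain l where "limitin (norm_topology V) y l sequentially"
    using assms(2) by (auto simp: schur_property_def)
  then have l: "l \<in> carrier V" "(\<lambda>n. nrm V (y n \<ominus>\<^bsub>V\<^esub> l)) \<longlonglongrightarrow> 0"
    by (simp_all add: V.limitin_norm_topology_iff[OF ycar])
  have sub: "strict_mono (\<lambda>n::nat. 2 * n)" "strict_mono (\<lambda>n::nat. 2 * n + 1)"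
    by (auto simp: strict_mono_def)
  have xl: "V.norm_tendsto x l"
    using LIMSEQ_subseq_LIMSEQ[OF l(2) sub(1)] l(1) car
    by (simp add: V.norm_tendsto_def o_def y_def)
  have "V.norm_tendsto (\<lambda>_. a) l"
    using LIMSEQ_subseq_LIMSEQ[OF l(2) sub(2)] l(1) car
    by (simp add: V.norm_tendsto_def o_def y_def)
  then have "a = l"
    using V.norm_tendsto_unique[OF V.norm_tendsto_const] car by blast
  with xl show ?thesis by simp
qed

text \<open>Banach-Steinhaus by way of Baire: the closed sets \<open>A N\<close> cover a complete
  space, so one of them contains a ball; translating that ball to the origin and rescaling turn this
  into a bound by the norm.\<close>

lemma (in banach_space) uniform_boundedness:
  assumes f: "\<And>j::nat. f j \<in> dual V" and bdd: "\<And>x. x \<in> carrier V \<Longrightarrow> Bseq (\<lambda>j. f j x)"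
  shows "\<exists>C\<ge>0. \<forall>j. \<forall>x\<in>carrier V. norm (f j x) \<le> C * nrm V x"
proof -
  interpret MS: Metric_space "carrier V" "norm_dist V" by (rule Metric_space_norm_dist)
  define A where "A N = {x \<in> carrier V. \<forall>j. norm (f j x) \<le> real N}" for N
  have f_add: "f j (x \<oplus> y) = f j x + f j y" and f_scale: "f j (c \<odot> x) = c * f j x"
    if "x \<in> carrier V" "y \<in> carrier V" for j x y c
    using f[of j] that by (auto simp: dual_def)
  have closed: "closedin MS.mtopology (A N)" for N
  proof -
    have "A N = (\<Inter>j. {x \<in> topspace (norm_topology V). f j x \<in> cball 0 (real N)})"
      by (auto simp: A_def)
    moreover have "closedin (norm_topology V) {x \<in> topspace (norm_topology V). f j x \<in> cball 0 (real N)}" for j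
      by (rule closedin_continuous_map_preimage) (use f[of j] in \<open>auto simp: dual_def\<close>)
    ultimately show ?thesis
      by (auto simp: norm_topology_eq intro!: closedin_INT)
  qed
  have "\<Union>(range A) = carrier V"
  proof (intro equalityI subsetI)
    fix x assume x: "x \<in> carrier V"
    obtain K where K: "\<And>j. norm (f j x) \<le> K" using bdd[OF x] by (auto simp: Bseq_def)
    have "x \<in> A (nat \<lceil>K\<rceil>)"
      using x K by (auto simp: A_def intro: order_trans real_nat_ceiling_ge)
    then show "x \<in> \<Union>(range A)" by blast
  qed (auto simp: A_def)
  then have "MS.mtopology interior_of \<Union>(range A) = carrier V"
    by (metis MS.topspace_mtopology interior_of_topspace)
  \<comment> \<open>The carrier contains zero. By Baire, a countable union of closed sets with empty
    interior could not have this interior.\<close>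
  then have "MS.mtopology interior_of \<Union>(range A) \<noteq> {}" by auto
  moreover have "MS.mcomplete" using complete by (simp add: mcomplete_of_def)
  ultimately obtain N where "MS.mtopology interior_of (A N) \<noteq> {}"
    using MS.metric_Baire_category_alt[of "range A"] closed by auto
  then obtain x0 where "x0 \<in> MS.mtopology interior_of (A N)" by blast
  moreover have "openin MS.mtopology (MS.mtopology interior_of (A N))" by simp
  ultimately obtain r where r: "0 < r" "MS.mball x0 r \<subseteq> MS.mtopology interior_of (A N)"
    unfolding MS.openin_mtopology by blast
  have ball: "x \<in> A N" if "x \<in> MS.mball x0 r" for x
    using subsetD[OF r(2) that] subsetD[OF interior_of_subset[of MS.mtopology "A N"]] by simp
  have x0: "x0 \<in> A N" "x0 \<in> carrier V"
    using subsetD[OF interior_of_subset \<open>x0 \<in> MS.mtopology interior_of (A N)\<close>]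
    by (auto simp: A_def)
  \<comment> \<open>Writing \<open>y\<close> as a difference of two points of \<open>A N\<close>,
    the shifted point and the centre of the ball, costs a factor 2.\<close>
  have small: "norm (f j y) \<le> 2 * real N" if y: "y \<in> carrier V" "nrm V y < r" for j y
  proof -
    have "x0 \<oplus> y \<ominus> x0 = y" using x0 y by (simp add: minus_eq a_comm a_assoc r_neg1 l_neg r_neg)
    then have "x0 \<oplus> y \<in> MS.mball x0 r"
      using x0 y seminorm_diff_commute[of x0 "x0 \<oplus> y"] by (simp add: MS.in_mball norm_dist_eq)
    then have "norm (f j (x0 \<oplus> y)) \<le> real N" "norm (f j x0) \<le> real N"
      using ball x0 by (auto simp: A_def)
    moreover have "f j y = f j (x0 \<oplus> y) - f j x0" using f_add x0 y by simp
    ultimately show ?thesis using norm_triangle_ineq4[of "f j (x0 \<oplus> y)" "f j x0"] by simp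
  qed
  show ?thesis
  \<comment> \<open>The bound \<open>2 * real N\<close> holds for vectors of norm
    \<open>r / 2\<close>; the quotient of the two numbers is the constant.\<close>
  proof (intro exI[of _ "4 * real N / r"] conjI allI ballI)
    show "0 \<le> 4 * real N / r" using r by simp
    fix j x assume x: "x \<in> carrier V"
    show "norm (f j x) \<le> 4 * real N / r * nrm V x"
    proof (cases "nrm V x = 0")
      case True
      then have "x = \<zero>" using x by (simp add: nrm_eq_0_iff)
      then show ?thesis using f_scale[of x x j 0] x by simp
    next
      case False
      then have pos: "0 < nrm V x" using nrm_nonneg[OF x] by simp
      \<comment> \<open>Scales \<open>x\<close> to norm \<open>r / 2\<close>, strictly inside the
        ball of radius \<open>r\<close>; the zero vector, which cannot be rescaled, was treated
        before.\<close>
      define c where "c = (of_real (r / (2 * nrm V x)) :: 'b)"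
      have c: "norm c = r / (2 * nrm V x)" unfolding c_def norm_of_real using r pos by simp
      have "norm (f j (c \<odot> x)) \<le> 2 * real N"
        using x pos r by (intro small) (auto simp: nrm_smult c)
      then have "r / (2 * nrm V x) * norm (f j x) \<le> 2 * real N"
        using x by (simp add: f_scale norm_mult c)
      then show ?thesis using r pos by (simp add: field_simps)
    qed
  qed
qed

text \<open>Split \<open>\<phi> j (x j)\<close> into \<open>\<phi> j (x j \<ominus> a)\<close> and
  \<open>\<phi> j a\<close>. The second part converges pointwise; the first is at most
  \<open>C * nrm V (x j \<ominus> a)\<close>, with \<open>C\<close> independent of \<open>j\<close>
  by uniform boundedness.\<close>

lemma (in banach_space) weak_star_norm_tendsto:
  assumes \<phi>: "weak_star_converges V \<phi> f" and x: "norm_tendsto x a"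
  shows "(\<lambda>j. \<phi> j (x j)) \<longlonglongrightarrow> f a"
proof -
  have dual: "\<And>j. \<phi> j \<in> dual V" and pw: "\<And>x. x \<in> carrier V \<Longrightarrow> (\<lambda>j. \<phi> j x) \<longlonglongrightarrow> f x"
    using \<phi> by (auto simp: weak_star_converges_def)
  have car: "\<And>j. x j \<in> carrier V" "a \<in> carrier V" and lim: "(\<lambda>j. nrm V (x j \<ominus> a)) \<longlonglongrightarrow> 0"
    using x by (auto simp: norm_tendsto_def)
  have bseq: "Bseq (\<lambda>j. \<phi> j x)" if "x \<in> carrier V" for x
    using pw[OF that] by (blast intro: convergent_imp_Bseq convergentI)
  obtain C where C: "0 \<le> C" "\<forall>j. \<forall>x\<in>carrier V. norm (\<phi> j x) \<le> C * nrm V x"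
    using uniform_boundedness[of \<phi>, OF dual bseq] by blast
  have "(\<lambda>j. \<phi> j (x j \<ominus> a)) \<longlonglongrightarrow> 0"
    by (rule Lim_null_comparison[OF _ tendsto_mult_right_zero[OF lim, of C]])
      (simp add: C car)
  from tendsto_add[OF this pw[OF car(2)]] have "(\<lambda>j. \<phi> j (x j \<ominus> a) + \<phi> j a) \<longlonglongrightarrow> f a"
    by simp
  moreover have "\<phi> j (x j \<ominus> a) + \<phi> j a = \<phi> j (x j)" for j
  proof -
    have "\<phi> j ((x j \<ominus> a) \<oplus> a) = \<phi> j (x j \<ominus> a) + \<phi> j a"
      using dual[of j] car by (simp add: dual_def)
    then show ?thesis using car by (simp add: diff_add)
  qed
  ultimately show ?thesis by simp
qed

section \<open>Isometric copies inside a sum type\<close>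

text \<open>Moves a space to the type over which \<open>DP_comp_L\<close> quantifies in the theorem.
  On the carriers, \<open>Inr\<close> and \<open>projr\<close> are mutually inverse linear
  isometries, so completeness and weak convergence can be transferred along them.\<close>

definition Inr_copy :: "('k, 'a) normed_module \<Rightarrow> ('k, 'g + 'a) normed_module" where
  "Inr_copy V =
     \<lparr>carrier = Inr ` carrier V, monoid.mult = undefined, one = undefined,
      ring.zero = Inr \<zero>\<^bsub>V\<^esub>, add = (\<lambda>x y. Inr (projr x \<oplus>\<^bsub>V\<^esub> projr y)),
      smult = (\<lambda>c x. Inr (c \<odot>\<^bsub>V\<^esub> projr x)), nrm = (\<lambda>x. nrm V (projr x))\<rparr>"

lemma Inr_copy_simps [simp]:
  "carrier (Inr_copy V) = Inr ` carrier V"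
  "\<zero>\<^bsub>Inr_copy V\<^esub> = Inr \<zero>\<^bsub>V\<^esub>"
  "x \<oplus>\<^bsub>Inr_copy V\<^esub> y = Inr (projr x \<oplus>\<^bsub>V\<^esub> projr y)"
  "c \<odot>\<^bsub>Inr_copy V\<^esub> x = Inr (c \<odot>\<^bsub>V\<^esub> projr x)"
  "nrm (Inr_copy V) x = nrm V (projr x)"
  by (simp_all add: Inr_copy_def)

lemma (in normed_space) normed_space_Inr_copy: "normed_space (Inr_copy V :: ('k, 'g + 'a) normed_module)"
proof -
  interpret C: scalar_module "Inr_copy V :: ('k, 'g + 'a) normed_module"
    by (rule scalar_moduleI)
      (auto simp: a_ac scale_add_left scale_add_right scale_scale)
  show ?thesis
    by unfold_locales (auto simp: nrm_nonneg nrm_triangle nrm_smult nrm_eq_0_iff)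
qed

lemma (in seminormed_space) Inr_copy_diff:
  assumes "scalar_module (Inr_copy V :: ('k, 'g + 'a) normed_module)" "x \<in> carrier V" "y \<in> carrier V"
  shows "Inr x \<ominus>\<^bsub>Inr_copy V\<^esub> Inr y = (Inr (x \<ominus> y) :: 'g + 'a)"
  using assms by (simp add: scalar_module.diff_eq_scale[OF assms(1)] diff_eq_scale)

lemma lin_map_Inr_copy:
  "lin_map V (Inr_copy V) Inr" "lin_map (Inr_copy V) V projr"
  by (auto simp: lin_map_def)

lemma banach_space_Inr_copy:
  fixes V :: "('k::real_normed_field, 'a) normed_module"
  assumes "banach_space V"
  shows "banach_space (Inr_copy V :: ('k, 'g + 'a) normed_module)"
proof -
  interpret V: banach_space V by fact
  interpret C: normed_space "Inr_copy V :: ('k, 'g + 'a) normed_module"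
    by (rule V.normed_space_Inr_copy)
  have "\<exists>l\<in>carrier (Inr_copy V :: ('k, 'g + 'a) normed_module).
      (\<lambda>n. nrm (Inr_copy V) (s n \<ominus>\<^bsub>Inr_copy V\<^esub> l)) \<longlonglongrightarrow> 0"
    if s: "s \<in> cauchy_seqs (Inr_copy V :: ('k, 'g + 'a) normed_module)" for s
  proof -
    have "(\<lambda>n. projr (s n)) \<in> cauchy_seqs V"
      by (rule C.lin_map_cauchy_seqs[OF V.seminormed_space_axioms lin_map_Inr_copy(2), of 1])
        (use s in auto)
    then obtain l where l: "l \<in> carrier V" "(\<lambda>n. nrm V (projr (s n) \<ominus>\<^bsub>V\<^esub> l)) \<longlonglongrightarrow> 0"
      by (rule V.cauchy_seqs_limit)
    have "s n \<ominus>\<^bsub>Inr_copy V\<^esub> Inr l = Inr (projr (s n) \<ominus>\<^bsub>V\<^esub> l)" for n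
      using C.cauchy_seqs_carrier[OF s, of n] l V.Inr_copy_diff[OF C.scalar_module_axioms] by auto
    then show ?thesis using l by (intro bexI[of _ "Inr l"]) simp_all
  qed
  then show ?thesis by (simp add: C.banach_space_iff)
qed

text \<open>A functional on \<open>V\<close> pulls back along the isometry \<open>projr\<close> to a
  functional on the copy, where weak convergence is assumed.\<close>

lemma (in normed_space) weakly_converges_Inr_copyD:
  fixes x :: "nat \<Rightarrow> 'g + 'a"
  assumes "weakly_converges (Inr_copy V) x a"
  shows "weakly_converges V (\<lambda>n. projr (x n)) (projr a)"
proof -
  have "(f \<circ> projr) \<in> dual (Inr_copy V :: ('k, 'g + 'a) normed_module)" if "f \<in> dual V" for f
  proof -
    have "continuous_map (norm_topology (Inr_copy V :: ('k, 'g + 'a) normed_module)) (norm_topology V) projr"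
      by (rule continuous_map_bounded_lin_map[OF normed_space_Inr_copy normed_space_axioms
            lin_map_Inr_copy(2), of 1]) auto
    then have "continuous_map (norm_topology (Inr_copy V :: ('k, 'g + 'a) normed_module)) euclidean (f \<circ> projr)"
      using that by (auto simp: dual_def intro: continuous_map_compose)
    then show ?thesis using that by (auto simp: dual_def)
  qed
  then show ?thesis
    using assms unfolding weakly_converges_def
    by (fastforce simp: image_subset_iff)
qed

section \<open>Bounded multilinear maps\<close>

lemma tuples_fun_upd:
  "x \<in> tuples m E \<Longrightarrow> i \<in> {1..m} \<Longrightarrow> a \<in> carrier (E i) \<Longrightarrow> x(i := a) \<in> tuples m E"
  by (auto simp: tuples_def PiE_iff extensional_def)

lemma tuplesD: "x \<in> tuples m E \<Longrightarrow> i \<in> {1..m} \<Longrightarrow> x i \<in> carrier (E i)"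
  by (auto simp: tuples_def)

lemma restrict_in_tuples:
  "(\<And>i. i \<in> {1..m} \<Longrightarrow> x i \<in> carrier (E i)) \<Longrightarrow> (\<lambda>i\<in>{1..m}. x i) \<in> tuples m E"
  by (auto simp: tuples_def)

lemma multilinearD:
  assumes "multilinear m E F T" "x \<in> tuples m E" "i \<in> {1..m}" "a \<in> carrier (E i)"
  shows "b \<in> carrier (E i) \<Longrightarrow> T (x(i := a \<oplus>\<^bsub>E i\<^esub> b)) = T (x(i := a)) \<oplus>\<^bsub>F\<^esub> T (x(i := b))"
    and "T (x(i := c \<odot>\<^bsub>E i\<^esub> a)) = c \<odot>\<^bsub>F\<^esub> T (x(i := a))"
  using assms by (auto simp: multilinear_def)

lemma multilinear_lin_map:
  assumes "multilinear m E V T" "T \<in> tuples m E \<rightarrow> carrier V" "lin_map V W u"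
  shows "multilinear m E W (\<lambda>x. u (T x))"
  using assms unfolding multilinear_def
  by (simp add: tuples_fun_upd lin_mapD Pi_iff)

locale normed_family =
  fixes m :: nat and E :: "nat \<Rightarrow> ('k::real_normed_field, 'a) normed_module"
  assumes normed_space_E: "i \<in> {1..m} \<Longrightarrow> normed_space (E i)"
begin

abbreviation nprod :: "(nat \<Rightarrow> 'a) \<Rightarrow> real" where
  "nprod x \<equiv> \<Prod>i\<in>{1..m}. nrm (E i) (x i)"

lemma E_closed:
  assumes "i \<in> {1..m}" "a \<in> carrier (E i)"
  shows "b \<in> carrier (E i) \<Longrightarrow> a \<oplus>\<^bsub>E i\<^esub> b \<in> carrier (E i)" "c \<odot>\<^bsub>E i\<^esub> a \<in> carrier (E i)"
proof -
  interpret Ei: normed_space "E i" by (rule normed_space_E[OF assms(1)])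
  show "b \<in> carrier (E i) \<Longrightarrow> a \<oplus>\<^bsub>E i\<^esub> b \<in> carrier (E i)" "c \<odot>\<^bsub>E i\<^esub> a \<in> carrier (E i)"
    using assms(2) by simp_all
qed

lemma multilinear_restrict:
  "multilinear m E V T \<Longrightarrow> multilinear m E V (\<lambda>x\<in>tuples m E. T x)"
  by (simp add: multilinear_def tuples_fun_upd E_closed del: atLeastAtMost_iff One_nat_def)

lemma nrm_E_nonneg: "x \<in> tuples m E \<Longrightarrow> i \<in> {1..m} \<Longrightarrow> 0 \<le> nrm (E i) (x i)"
  using normed_space.nrm_nonneg[OF normed_space_E] by (simp add: tuplesD)

lemma nprod_nonneg: "x \<in> tuples m E \<Longrightarrow> 0 \<le> nprod x"
  by (intro prod_nonneg ballI nrm_E_nonneg)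

lemma multilinear_eq_zero:
  assumes "seminormed_space W" "multilinear m E W T" "T \<in> tuples m E \<rightarrow> carrier W"
    and x: "x \<in> tuples m E" and i: "i \<in> {1..m}" "x i = \<zero>\<^bsub>E i\<^esub>"
  shows "T x = \<zero>\<^bsub>W\<^esub>"
proof -
  interpret W: seminormed_space W by fact
  interpret Ei: normed_space "E i" by (rule normed_space_E[OF i(1)])
  \<comment> \<open>Homogeneity in slot \<open>i\<close> alone gives this, since the zero vector is
    \<open>0\<close> times itself.\<close>
  have "T (x(i := 0 \<odot>\<^bsub>E i\<^esub> \<zero>\<^bsub>E i\<^esub>)) = 0 \<odot>\<^bsub>W\<^esub> T (x(i := \<zero>\<^bsub>E i\<^esub>))"
    by (rule multilinearD(2)[OF assms(2) x i(1)]) simp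
  then show ?thesis
    using assms(3) x i fun_upd_triv[of x i] by (simp add: Pi_iff)
qed

text \<open>Homogeneity acts on one slot at a time, so the scaled slots are collected in a set
  \<open>J\<close> and the proof is an induction on \<open>J\<close>; \<open>y J\<close> is the
  tuple scaled exactly at the slots in \<open>J\<close>.\<close>

lemma multilinear_scale:
  assumes T: "multilinear m E W T" "T \<in> tuples m E \<rightarrow> carrier W" and "seminormed_space W"
    and x: "x \<in> tuples m E"
  shows "T (\<lambda>i\<in>{1..m}. c i \<odot>\<^bsub>E i\<^esub> x i) = (\<Prod>i\<in>{1..m}. c i) \<odot>\<^bsub>W\<^esub> T x"
proof -
  interpret W: seminormed_space W by fact
  define y where "y J = (\<lambda>i\<in>{1..m}. if i \<in> J then c i \<odot>\<^bsub>E i\<^esub> x i else x i)" for J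
  have y: "y J \<in> tuples m E" for J
    unfolding y_def
  proof (rule restrict_in_tuples)
    fix i assume i: "i \<in> {1..m}"
    interpret Ei: normed_space "E i" by (rule normed_space_E[OF i])
    show "(if i \<in> J then c i \<odot>\<^bsub>E i\<^esub> x i else x i) \<in> carrier (E i)"
      using tuplesD[OF x i] by simp
  qed
  have "T (y J) = (\<Prod>i\<in>J. c i) \<odot>\<^bsub>W\<^esub> T x" if "J \<subseteq> {1..m}" for J
    using finite_subset[OF that finite_atLeastAtMost] that
  proof (induction J rule: finite_induct)
    case empty
    have "y {} = x" using x by (auto simp: y_def tuples_def PiE_iff extensional_def restrict_def)
    then show ?case using T x by (auto simp: Pi_iff)
  next
    case (insert j J)
    have j: "j \<in> {1..m}" using insert.prems by simp
    have "y (insert j J) = (y J)(j := c j \<odot>\<^bsub>E j\<^esub> x j)" and yj: "(y J)(j := x j) = y J"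
      using j insert.hyps by (auto simp: y_def)
    then have "T (y (insert j J)) = c j \<odot>\<^bsub>W\<^esub> T (y J)"
      using multilinearD(2)[OF T(1) y j tuplesD[OF x j]] by simp
    also have "\<dots> = c j \<odot>\<^bsub>W\<^esub> ((\<Prod>i\<in>J. c i) \<odot>\<^bsub>W\<^esub> T x)"
      using insert by simp
    also have "\<dots> = (\<Prod>i\<in>insert j J. c i) \<odot>\<^bsub>W\<^esub> T x"
      using insert.hyps T x by (simp add: W.scale_scale Pi_iff)
    finally show ?case .
  qed
  from this[of "{1..m}"] show ?thesis by (simp add: y_def cong: restrict_cong)
qed

text \<open>Continuity at the zero tuple yields a box with radii \<open>\<delta> i\<close> on which
  \<open>T\<close> has norm below 1. Each coordinate of a tuple is scaled into the box separately,
  and multilinearity takes out the product of the factors.\<close>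

lemma cont_multilinear_bounded:
  assumes "normed_space W" "1 \<le> m" and T: "T \<in> cont_multilinear m E W"
  shows "\<exists>C>0. \<forall>x\<in>tuples m E. nrm W (T x) \<le> C * nprod x"
proof -
  interpret W: normed_space W by fact
  interpret MW: Metric_space "carrier W" "norm_dist W" by (rule W.Metric_space_norm_dist)
  have T': "multilinear m E W T" "T \<in> tuples m E \<rightarrow> carrier W"
    and cont: "continuous_map (product_topology (\<lambda>i. norm_topology (E i)) {1..m}) (norm_topology W) T"
    using T by (auto simp: cont_multilinear_def)
  define z where "z = (\<lambda>i\<in>{1..m}. \<zero>\<^bsub>E i\<^esub>)"
  have z: "z \<in> tuples m E"
    unfolding z_def
  proof (rule restrict_in_tuples)
    fix i assume "i \<in> {1..m}"
    then interpret Ei: normed_space "E i" by (rule normed_space_E)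
    show "\<zero>\<^bsub>E i\<^esub> \<in> carrier (E i)" by simp
  qed
  \<comment> \<open>With \<open>1 \<le> m\<close> there is a slot, namely 1, in which
    \<open>z\<close> vanishes.\<close>
  have Tz: "T z = \<zero>\<^bsub>W\<^esub>"
    by (rule multilinear_eq_zero[OF W.seminormed_space_axioms T' z, of 1])
      (use \<open>1 \<le> m\<close> in \<open>auto simp: z_def\<close>)
  let ?X = "product_topology (\<lambda>i. norm_topology (E i)) {1..m}"
  have top: "topspace ?X = tuples m E"
    by (auto simp: tuples_def intro!: PiE_cong normed_space.topspace_norm_topology normed_space_E)
  have "\<forall>\<epsilon>>0. \<exists>U. openin ?X U \<and> z \<in> U \<and> (\<forall>y\<in>U. T y \<in> MW.mball (T z) \<epsilon>)"
    using cont unfolding W.norm_topology_eq MW.continuous_map_to_metric top by (rule bspec) (rule z)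
  then obtain U where U: "openin ?X U" "z \<in> U" "\<forall>y\<in>U. T y \<in> MW.mball (T z) 1"
    using zero_less_one by blast
  have "\<exists>B. finite {i \<in> {1..m}. B i \<noteq> topspace (norm_topology (E i))} \<and>
      (\<forall>i\<in>{1..m}. openin (norm_topology (E i)) (B i)) \<and> z \<in> Pi\<^sub>E {1..m} B \<and> Pi\<^sub>E {1..m} B \<subseteq> U"
    using U(1) unfolding openin_product_topology_alt by (rule bspec) (rule U(2))
  then obtain B where B: "\<forall>i\<in>{1..m}. openin (norm_topology (E i)) (B i)"
      "z \<in> Pi\<^sub>E {1..m} B" "Pi\<^sub>E {1..m} B \<subseteq> U"
    by (elim exE conjE) (rule that)
  have "\<exists>\<delta>>0. \<forall>y\<in>carrier (E i). nrm (E i) y < \<delta> \<longrightarrow> y \<in> B i" if i: "i \<in> {1..m}" for i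
  proof -
    interpret Ei: normed_space "E i" by (rule normed_space_E[OF i])
    interpret Mi: Metric_space "carrier (E i)" "norm_dist (E i)" by (rule Ei.Metric_space_norm_dist)
    have "\<zero>\<^bsub>E i\<^esub> \<in> B i" using PiE_mem[OF B(2) i] i by (simp add: z_def)
    then obtain r where r: "r > 0" "Mi.mball \<zero>\<^bsub>E i\<^esub> r \<subseteq> B i"
      using bspec[OF B(1) i] unfolding Ei.norm_topology_eq Mi.openin_mtopology by blast
    have "y \<in> B i" if "y \<in> carrier (E i)" "nrm (E i) y < r" for y
      using that Ei.seminorm_diff_commute[of "\<zero>\<^bsub>E i\<^esub>" y]
      by (intro subsetD[OF r(2)]) (simp add: Ei.norm_dist_eq Ei.diff_zero)
    then show ?thesis using r by blast
  qed
  then obtain \<delta> where \<delta>: "\<And>i. i \<in> {1..m} \<Longrightarrow> 0 < \<delta> i"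
    "\<And>i y. i \<in> {1..m} \<Longrightarrow> y \<in> carrier (E i) \<Longrightarrow> nrm (E i) y < \<delta> i \<Longrightarrow> y \<in> B i"
    by metis
  have small: "nrm W (T y) < 1"
    if y: "y \<in> tuples m E" and yd: "\<And>i. i \<in> {1..m} \<Longrightarrow> nrm (E i) (y i) < \<delta> i" for y
  proof -
    have "y \<in> Pi\<^sub>E {1..m} B"
      using y yd \<delta>(2) by (auto simp: tuples_def PiE_iff)
    then have "T y \<in> MW.mball (T z) 1" using B(3) U(3) by blast
    then show ?thesis
      using W.seminorm_diff_commute[of "\<zero>\<^bsub>W\<^esub>" "T y"] by (auto simp: Tz W.norm_dist_eq W.diff_zero)
  qed
  let ?C = "\<Prod>i\<in>{1..m}. 2 / \<delta> i"
  show ?thesis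
  proof (intro exI[of _ ?C] conjI ballI)
    show "0 < ?C" using \<delta>(1) by (intro prod_pos ballI) auto
    fix x assume x: "x \<in> tuples m E"
    show "nrm W (T x) \<le> ?C * nprod x"
    proof (cases "\<exists>i\<in>{1..m}. nrm (E i) (x i) = 0")
      \<comment> \<open>A coordinate of norm zero cannot be scaled, but then multilinearity forces
        \<open>T x\<close> to vanish.\<close>
      case True
      then obtain i where i: "i \<in> {1..m}" "nrm (E i) (x i) = 0" by blast
      interpret Ei: normed_space "E i" by (rule normed_space_E[OF i(1)])
      have "x i = \<zero>\<^bsub>E i\<^esub>" using i tuplesD[OF x i(1)] by (simp add: Ei.nrm_eq_0_iff)
      then have "T x = \<zero>\<^bsub>W\<^esub>"
        by (rule multilinear_eq_zero[OF W.seminormed_space_axioms T' x i(1)])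
      moreover have "0 \<le> ?C * nprod x"
        using \<open>0 < ?C\<close> nprod_nonneg[OF x] by (intro mult_nonneg_nonneg) auto
      ultimately show ?thesis by simp
    next
      case False
      then have pos: "0 < nrm (E i) (x i)" if "i \<in> {1..m}" for i
        using nrm_E_nonneg[OF x that] that by force
      \<comment> \<open>Brings coordinate \<open>i\<close> to norm \<open>\<delta> i / 2\<close>,
        strictly inside the box; the inverse factors \<open>2 * nrm (E i) (x i) / \<delta> i\<close>
        multiply up to \<open>?C * nprod x\<close>.\<close>
      define c :: "nat \<Rightarrow> 'k" where "c i = of_real (\<delta> i / (2 * nrm (E i) (x i)))" for i
      have c: "norm (c i) = \<delta> i / (2 * nrm (E i) (x i))" if "i \<in> {1..m}" for i
        unfolding c_def norm_of_real using \<delta>(1)[OF that] pos[OF that] by simp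
      let ?y = "\<lambda>i\<in>{1..m}. c i \<odot>\<^bsub>E i\<^esub> x i"
      have sc: "c i \<odot>\<^bsub>E i\<^esub> x i \<in> carrier (E i) \<and> nrm (E i) (c i \<odot>\<^bsub>E i\<^esub> x i) < \<delta> i" if i: "i \<in> {1..m}" for i
      proof -
        interpret Ei: normed_space "E i" by (rule normed_space_E[OF i])
        show ?thesis using tuplesD[OF x i] \<delta>(1)[OF i] pos[OF i] by (simp add: Ei.nrm_smult c[OF i])
      qed
      have "nrm W (T ?y) < 1"
        by (rule small[OF restrict_in_tuples]) (use sc in auto)
      then have "(\<Prod>i\<in>{1..m}. norm (c i)) * nrm W (T x) < 1"
        using multilinear_scale[OF T' W.seminormed_space_axioms x, of c] T'(2) x
        by (simp add: W.nrm_smult Pi_iff prod_norm)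
      moreover have "(\<Prod>i\<in>{1..m}. norm (c i)) * (?C * nprod x) = 1"
      proof -
        have "(\<Prod>i\<in>{1..m}. norm (c i)) * (?C * nprod x)
            = (\<Prod>i\<in>{1..m}. norm (c i) * (2 / \<delta> i * nrm (E i) (x i)))"
          by (simp only: prod.distrib)
        also have "\<dots> = (\<Prod>i\<in>{1..m}. 1)"
          using c \<delta>(1) pos by (intro prod.cong refl) (simp add: field_simps less_imp_neq[symmetric])
        finally show ?thesis by simp
      qed
      moreover have "0 < (\<Prod>i\<in>{1..m}. norm (c i))"
        using c \<delta>(1) pos by (intro prod_pos ballI) auto
      ultimately have "(\<Prod>i\<in>{1..m}. norm (c i)) * nrm W (T x) \<le> (\<Prod>i\<in>{1..m}. norm (c i)) * (?C * nprod x)"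
        by simp
      then show ?thesis
        using \<open>0 < (\<Prod>i\<in>{1..m}. norm (c i))\<close> by (rule mult_left_le_imp_le)
    qed
  qed
qed

text \<open>The difference \<open>T x - T a\<close> telescopes by exchanging one coordinate at a time.\<close>

lemma multilinear_diff_bound:
  assumes "normed_space W" and T: "multilinear m E W T" "T \<in> tuples m E \<rightarrow> carrier W"
    and C: "0 \<le> C" "\<And>x. x \<in> tuples m E \<Longrightarrow> nrm W (T x) \<le> C * nprod x"
    and x: "x \<in> tuples m E" and a: "a \<in> tuples m E" and \<delta>: "0 \<le> \<delta>" "\<delta> \<le> 1"
    and close: "\<And>i. i \<in> {1..m} \<Longrightarrow> nrm (E i) (x i \<ominus>\<^bsub>E i\<^esub> a i) \<le> \<delta>"
  shows "nrm W (T x \<ominus>\<^bsub>W\<^esub> T a) \<le> m * (C * (\<delta> * (\<Prod>i\<in>{1..m}. nrm (E i) (a i) + 1)))"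
proof -
  interpret W: normed_space W by fact
  let ?P = "\<Prod>i\<in>{1..m}. nrm (E i) (a i) + 1"
  define h where "h k = (\<lambda>i\<in>{1..m}. if i \<le> k then x i else a i)" for k
  have h: "h k \<in> tuples m E" for k
    unfolding h_def by (rule restrict_in_tuples) (use x a in \<open>auto simp: tuplesD\<close>)
  have Tcar: "T y \<in> carrier W" if "y \<in> tuples m E" for y using T that by auto
  have "nrm W (T (h k) \<ominus>\<^bsub>W\<^esub> T a) \<le> k * (C * (\<delta> * ?P))" if "k \<le> m" for k
    using that
  proof (induction k)
    case 0
    have "h 0 = a" using a by (auto simp: h_def tuples_def PiE_iff extensional_def restrict_def)
    then show ?case using Tcar[OF a] by (simp add: W.diff_self)
  next
    case (Suc k)
    let ?j = "Suc k"
    have j: "?j \<in> {1..m}" using Suc.prems by simp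
    interpret Ej: normed_space "E ?j" by (rule normed_space_E[OF j])
    let ?d = "x ?j \<ominus>\<^bsub>E ?j\<^esub> a ?j"
    have car: "x ?j \<in> carrier (E ?j)" "a ?j \<in> carrier (E ?j)" using x a j by (auto simp: tuplesD)
    then have d: "?d \<in> carrier (E ?j)" by simp
    have hS: "h ?j = (h k)(?j := ?d \<oplus>\<^bsub>E ?j\<^esub> a ?j)" and hk: "(h k)(?j := a ?j) = h k"
      using j car by (auto simp: h_def Ej.diff_add)
    have "T (h ?j) = T ((h k)(?j := ?d)) \<oplus>\<^bsub>W\<^esub> T (h k)"
      using multilinearD(1)[OF T(1) h j d car(2), of k] unfolding hS hk .
    moreover have hd: "(h k)(?j := ?d) \<in> tuples m E" by (rule tuples_fun_upd[OF h j d])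
    ultimately have "nrm W (T (h ?j) \<ominus>\<^bsub>W\<^esub> T a) \<le>
        nrm W (T ((h k)(?j := ?d))) + nrm W (T (h k) \<ominus>\<^bsub>W\<^esub> T a)"
      using W.nrm_triangle[of "T ((h k)(?j := ?d))" "T (h k) \<ominus>\<^bsub>W\<^esub> T a"] Tcar h a
      by (simp add: W.minus_eq W.a_assoc)
    also have "nrm W (T ((h k)(?j := ?d))) \<le> C * (\<delta> * ?P)"
    proof -
      \<comment> \<open>The exchanged slot contributes at most \<open>\<delta>\<close>. Every other
        slot holds \<open>a i\<close> or \<open>x i\<close>, both of norm at most
        \<open>nrm (E i) (a i) + 1\<close> because \<open>\<delta> \<le> 1\<close>. Keeping that
        factor, which is at least 1, in the exchanged slot too makes the bound the same for all
        \<open>k\<close>.\<close>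
      have "nprod ((h k)(?j := ?d)) \<le> (\<Prod>i\<in>{1..m}. (if i = ?j then \<delta> else 1) * (nrm (E i) (a i) + 1))"
      proof (intro prod_mono conjI)
        fix i assume i: "i \<in> {1..m}"
        show "0 \<le> nrm (E i) (((h k)(?j := ?d)) i)" by (rule nrm_E_nonneg[OF hd i])
        interpret Ei: normed_space "E i" by (rule normed_space_E[OF i])
        have cari: "x i \<in> carrier (E i)" "a i \<in> carrier (E i)" using x a i by (auto simp: tuplesD)
        have na: "0 \<le> nrm (E i) (a i)" using cari by (simp add: Ei.nrm_nonneg)
        show "nrm (E i) (((h k)(?j := ?d)) i) \<le> (if i = ?j then \<delta> else 1) * (nrm (E i) (a i) + 1)"
        proof (cases "i = ?j")
          case True
          have "\<delta> \<le> \<delta> * (nrm (E i) (a i) + 1)" using \<delta> na by (simp add: mult_le_cancel_left1)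
          then show ?thesis using close[OF j] True by simp
        next
          case False
          have "nrm (E i) (x i) \<le> nrm (E i) (a i) + 1"
            using Ei.seminorm_le_diff[OF cari] close[OF i] \<delta> by linarith
          then show ?thesis using False na i by (simp add: h_def)
        qed
      qed
      also have "\<dots> = \<delta> * ?P"
        using j by (simp add: prod.distrib)
      finally show ?thesis
        using C(2)[OF hd] mult_left_mono[OF _ C(1)] by (meson order_trans)
    qed
    finally show ?case using Suc.IH Suc.prems by (simp add: algebra_simps)
  qed
  from this[of m] have "nrm W (T (h m) \<ominus>\<^bsub>W\<^esub> T a) \<le> m * (C * (\<delta> * ?P))" by simp
  moreover have "h m = x" using x by (auto simp: h_def tuples_def PiE_iff extensional_def restrict_def)
  ultimately show ?thesis by simp
qed

lemma continuous_map_bounded_multilinear: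
  assumes "normed_space W" and T: "multilinear m E W T" "T \<in> tuples m E \<rightarrow> carrier W"
    and C: "0 \<le> C" "\<And>x. x \<in> tuples m E \<Longrightarrow> nrm W (T x) \<le> C * nprod x"
  shows "continuous_map (product_topology (\<lambda>i. norm_topology (E i)) {1..m}) (norm_topology W) T"
proof -
  interpret W: normed_space W by fact
  interpret MW: Metric_space "carrier W" "norm_dist W" by (rule W.Metric_space_norm_dist)
  let ?X = "product_topology (\<lambda>i. norm_topology (E i)) {1..m}"
  have top: "topspace ?X = tuples m E"
    by (auto simp: tuples_def intro!: PiE_cong normed_space.topspace_norm_topology normed_space_E)
  show ?thesis
    unfolding W.norm_topology_eq MW.continuous_map_to_metric top
  proof (intro ballI allI impI)
    fix a and e :: real assume a: "a \<in> tuples m E" and e: "0 < e"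
    define K where "K = m * (C * (\<Prod>i\<in>{1..m}. nrm (E i) (a i) + 1))"
    have K: "0 \<le> K"
      unfolding K_def using nrm_E_nonneg[OF a] C(1)
      by (intro mult_nonneg_nonneg prod_nonneg ballI) (auto intro: add_nonneg_nonneg)
    \<comment> \<open>The bound 1 is required by \<open>multilinear_diff_bound\<close>; dividing by
      \<open>K + 1\<close> avoids a zero denominator and makes \<open>\<delta> * K < e\<close>
      strict.\<close>
    define \<delta> where "\<delta> = min 1 (e / (K + 1))"
    have \<delta>: "0 < \<delta>" "\<delta> \<le> 1" using e K by (auto simp: \<delta>_def)
    have "\<delta> * K < e"
    proof -
      have "\<delta> * K \<le> e / (K + 1) * K" using K by (intro mult_right_mono) (auto simp: \<delta>_def)
      also have "\<dots> < e" using e K by (simp add: field_simps)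
      finally show ?thesis .
    qed
    let ?B = "\<lambda>i. Metric_space.mball (carrier (E i)) (norm_dist (E i)) (a i) \<delta>"
    show "\<exists>U. openin ?X U \<and> a \<in> U \<and> (\<forall>x\<in>U. T x \<in> MW.mball (T a) e)"
    proof (intro exI[of _ "Pi\<^sub>E {1..m} ?B"] conjI ballI)
      have "openin (norm_topology (E i)) (?B i)" if i: "i \<in> {1..m}" for i
      proof -
        interpret Ei: normed_space "E i" by (rule normed_space_E[OF i])
        interpret Mi: Metric_space "carrier (E i)" "norm_dist (E i)" by (rule Ei.Metric_space_norm_dist)
        show ?thesis unfolding Ei.norm_topology_eq by simp
      qed
      then show "openin ?X (Pi\<^sub>E {1..m} ?B)" by (simp add: openin_PiE)
      have inB: "y \<in> ?B i \<longleftrightarrow> y \<in> carrier (E i) \<and> nrm (E i) (y \<ominus>\<^bsub>E i\<^esub> a i) < \<delta>" if i: "i \<in> {1..m}" for i y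
      proof -
        interpret Ei: normed_space "E i" by (rule normed_space_E[OF i])
        interpret Mi: Metric_space "carrier (E i)" "norm_dist (E i)" by (rule Ei.Metric_space_norm_dist)
        show ?thesis using tuplesD[OF a i] Ei.seminorm_diff_commute[of "a i" y]
          by (auto simp: Ei.norm_dist_eq)
      qed
      have "a i \<in> ?B i" if i: "i \<in> {1..m}" for i
      proof -
        interpret Ei: normed_space "E i" by (rule normed_space_E[OF i])
        show ?thesis using inB[OF i] tuplesD[OF a i] \<delta> by (simp add: Ei.diff_self)
      qed
      then show "a \<in> Pi\<^sub>E {1..m} ?B" using a by (auto simp: tuples_def PiE_iff)
      fix x assume xB: "x \<in> Pi\<^sub>E {1..m} ?B"
      then have x: "x \<in> tuples m E" using inB by (auto simp: tuples_def PiE_iff)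
      have "nrm W (T x \<ominus>\<^bsub>W\<^esub> T a) \<le> m * (C * (\<delta> * (\<Prod>i\<in>{1..m}. nrm (E i) (a i) + 1)))"
        by (rule multilinear_diff_bound[OF \<open>normed_space W\<close> T C x a])
          (use \<delta> xB inB in \<open>auto simp: PiE_iff less_imp_le\<close>)
      also have "\<dots> = \<delta> * K" by (simp add: K_def)
      finally have "nrm W (T x \<ominus>\<^bsub>W\<^esub> T a) < e" using \<open>\<delta> * K < e\<close> by simp
      moreover have "T x \<in> carrier W" "T a \<in> carrier W" using T x a by auto
      ultimately show "T x \<in> MW.mball (T a) e"
        using W.seminorm_diff_commute[of "T a" "T x"] by (simp add: W.norm_dist_eq)
    qed
  qed
qed

end

section \<open>The projective tensor product\<close>

lemma lookup_pm_scale [simp]: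
  "Poly_Mapping.lookup (pm_scale c p) x = c * Poly_Mapping.lookup p x"
  by (simp add: pm_scale_def Poly_Mapping.map.rep_eq when_def)

lemma keys_pm_scale: "Poly_Mapping.keys (pm_scale c p) \<subseteq> Poly_Mapping.keys p"
  by (auto simp: in_keys_iff)

lemma free_space_closed:
  "0 \<in> free_space m E"
  "p \<in> free_space m E \<Longrightarrow> q \<in> free_space m E \<Longrightarrow> p + q \<in> free_space m E"
  "p \<in> free_space m E \<Longrightarrow> q \<in> free_space m E \<Longrightarrow> p - q \<in> free_space m E"
  "p \<in> free_space m E \<Longrightarrow> pm_scale c p \<in> free_space m E"
  "x \<in> tuples m E \<Longrightarrow> Poly_Mapping.single x c \<in> free_space m E"
  using Poly_Mapping.keys_add[of p q] keys_diff[of p q] keys_pm_scale[of c p]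
  by (auto simp: free_space_def)

text \<open>Puts the formal sums into record form so that \<open>tensor_space\<close> becomes an
  instance of \<open>quotient_module\<close>.\<close>

definition free_module ::
    "nat \<Rightarrow> (nat \<Rightarrow> ('k::real_normed_field, 'a) normed_module) \<Rightarrow> ('k, (nat \<Rightarrow> 'a) \<Rightarrow>\<^sub>0 'k) module" where
  "free_module m E =
     \<lparr>carrier = free_space m E, monoid.mult = undefined, one = undefined,
      ring.zero = 0, add = (+), smult = pm_scale\<rparr>"

lemma free_module_simps [simp]:
  "carrier (free_module m E) = free_space m E"
  "\<zero>\<^bsub>free_module m E\<^esub> = 0"
  "p \<oplus>\<^bsub>free_module m E\<^esub> q = p + q"
  "c \<odot>\<^bsub>free_module m E\<^esub> p = pm_scale c p"
  by (simp_all add: free_module_def)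

lemma scalar_module_free_module: "scalar_module (free_module m E)"
  by (rule scalar_moduleI)
    (auto simp: free_space_closed algebra_simps pm.scale_left_distrib pm.scale_right_distrib)

lemma tensor_equiv_iff:
  "(p, q) \<in> tensor_equiv m E \<longleftrightarrow>
    p \<in> free_space m E \<and> q \<in> free_space m E \<and> p - q \<in> pm.span (tensor_relations m E)"
  by (simp add: tensor_equiv_def)

lemma equiv_tensor_equiv: "equiv (free_space m E) (tensor_equiv m E)"
proof (rule equivI)
  show "tensor_equiv m E \<subseteq> free_space m E \<times> free_space m E"
    by (auto simp: tensor_equiv_iff)
  show "refl_on (free_space m E) (tensor_equiv m E)"
    by (auto simp: refl_on_def tensor_equiv_iff pm.span_zero)
  show "sym (tensor_equiv m E)"
    by (rule symI) (use pm.span_neg in \<open>force simp: tensor_equiv_iff\<close>)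
  show "trans (tensor_equiv m E)"
  proof (rule transI)
    fix p q r assume "(p, q) \<in> tensor_equiv m E" "(q, r) \<in> tensor_equiv m E"
    then show "(p, r) \<in> tensor_equiv m E"
      using pm.span_add[of "p - q" "tensor_relations m E" "q - r"] by (simp add: tensor_equiv_iff)
  qed
qed

lemma quotient_module_tensor_space:
  "quotient_module (free_module m E) (tensor_equiv m E) (tensor_space m E)"
proof (intro quotient_module.intro quotient_module_axioms.intro scalar_module_free_module)
  show "equiv (carrier (free_module m E)) (tensor_equiv m E)"
    by (simp add: equiv_tensor_equiv)
next
  fix p p' q q' assume "(p, p') \<in> tensor_equiv m E" "(q, q') \<in> tensor_equiv m E"
  then show "(p \<oplus>\<^bsub>free_module m E\<^esub> q, p' \<oplus>\<^bsub>free_module m E\<^esub> q') \<in> tensor_equiv m E"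
    using pm.span_add[of "p - p'" "tensor_relations m E" "q - q'"]
    by (simp add: tensor_equiv_iff free_space_closed algebra_simps)
next
  fix p q c assume "(p, q) \<in> tensor_equiv m E"
  then show "(c \<odot>\<^bsub>free_module m E\<^esub> p, c \<odot>\<^bsub>free_module m E\<^esub> q) \<in> tensor_equiv m E"
    using pm.span_scale[of "p - q" "tensor_relations m E" c]
    by (simp add: tensor_equiv_iff free_space_closed pm.scale_right_diff_distrib)
qed (simp_all add: tensor_space_def)

abbreviation tclass where "tclass m E p \<equiv> tensor_equiv m E `` {p}"

lemmas tclass_closed = quotient_module.class_closed[OF quotient_module_tensor_space, simplified]
lemmas tclass_cases = quotient_module.class_cases[OF quotient_module_tensor_space, simplified]
lemmas tclass_add = quotient_module.class_add[OF quotient_module_tensor_space, simplified]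
lemmas tclass_scale = quotient_module.class_scale[OF quotient_module_tensor_space, simplified]
lemmas tclass_eq_iff = quotient_module.class_eq_iff[OF quotient_module_tensor_space, simplified]
lemmas scalar_module_tensor_space = quotient_module.scalar_module_Q[OF quotient_module_tensor_space]

lemma in_tclass_self: "p \<in> free_space m E \<Longrightarrow> p \<in> tclass m E p"
  by (rule equiv_class_self[OF equiv_tensor_equiv])

section \<open>The projective seminorm\<close>

context normed_family
begin

text \<open>A weighted l1-seminorm on formal sums; the projective seminorm is the quotient seminorm
  that it induces.\<close>

definition weight :: "((nat \<Rightarrow> 'a) \<Rightarrow>\<^sub>0 'k) \<Rightarrow> real" where
  "weight p = (\<Sum>x\<in>Poly_Mapping.keys p. norm (Poly_Mapping.lookup p x) * nprod x)"

lemma nrm_tensor_space: "nrm (tensor_space m E) A = (INF p\<in>A. weight p)"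
  by (simp add: tensor_space_def weight_def)

text \<open>Allows \<open>p\<close>, \<open>q\<close> and \<open>p + q\<close> to be summed over one
  common index set although cancellation may shrink the support.\<close>

lemma weight_superset:
  assumes "finite S" "Poly_Mapping.keys p \<subseteq> S"
  shows "weight p = (\<Sum>x\<in>S. norm (Poly_Mapping.lookup p x) * nprod x)"
  unfolding weight_def by (rule sum.mono_neutral_left) (use assms in \<open>auto simp: in_keys_iff\<close>)

lemma weight_nonneg: "p \<in> free_space m E \<Longrightarrow> 0 \<le> weight p"
  unfolding weight_def free_space_def
  by (intro sum_nonneg mult_nonneg_nonneg nprod_nonneg) auto

lemma weight_add:
  assumes "p \<in> free_space m E" "q \<in> free_space m E"
  shows "weight (p + q) \<le> weight p + weight q"
proof -
  let ?S = "Poly_Mapping.keys p \<union> Poly_Mapping.keys q"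
  have "weight (p + q) = (\<Sum>x\<in>?S. norm (Poly_Mapping.lookup (p + q) x) * nprod x)"
    by (rule weight_superset) (simp_all add: Poly_Mapping.keys_add)
  also have "\<dots> \<le> (\<Sum>x\<in>?S. norm (Poly_Mapping.lookup p x) * nprod x + norm (Poly_Mapping.lookup q x) * nprod x)"
  proof (rule sum_mono)
    fix x assume "x \<in> ?S"
    then have "x \<in> tuples m E" using assms by (auto simp: free_space_def)
    then show "norm (Poly_Mapping.lookup (p + q) x) * nprod x
        \<le> norm (Poly_Mapping.lookup p x) * nprod x + norm (Poly_Mapping.lookup q x) * nprod x"
      unfolding distrib_right[symmetric] lookup_add
      by (intro mult_right_mono norm_triangle_ineq nprod_nonneg)
  qed
  also have "\<dots> = weight p + weight q"
    by (simp add: sum.distrib weight_superset[of ?S])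
  finally show ?thesis .
qed

lemma weight_scale: "weight (pm_scale c p) = norm c * weight p"
  using weight_superset[OF finite_keys keys_pm_scale, of c p]
  by (simp add: weight_def norm_mult sum_distrib_left mult.assoc)

lemma weight_zero [simp]: "weight 0 = 0"
  by (simp add: weight_def)

lemma weight_single: "weight (Poly_Mapping.single x c) = norm c * nprod x"
  by (simp add: weight_def)

text \<open>Together with \<open>nrm_tclass_ge\<close> this replaces all further direct work with
  the infimum.\<close>

lemma nrm_tclass_le:
  assumes "p \<in> free_space m E" "q \<in> tclass m E p"
  shows "nrm (tensor_space m E) (tclass m E p) \<le> weight q"
  unfolding nrm_tensor_space
  by (rule cINF_lower[OF bdd_belowI2[of _ 0]]) (use assms in \<open>auto simp: tensor_equiv_iff weight_nonneg\<close>)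

lemma nrm_tclass_ge:
  assumes "p \<in> free_space m E" "\<And>q. q \<in> tclass m E p \<Longrightarrow> b \<le> weight q"
  shows "b \<le> nrm (tensor_space m E) (tclass m E p)"
  unfolding nrm_tensor_space
  by (rule cINF_greatest) (use assms in_tclass_self[OF assms(1)] in auto)

lemma seminormed_space_tensor_space: "seminormed_space (tensor_space m E)"
proof -
  interpret T: scalar_module "tensor_space m E" by (rule scalar_module_tensor_space)
  let ?N = "nrm (tensor_space m E)"
  \<comment> \<open>Only one inequality is proved from representations; applying it to
    \<open>inverse c\<close> as well gives the reverse one for \<open>c \<noteq> 0\<close>.\<close>
  have scale_le: "?N (tclass m E (pm_scale c p)) \<le> norm c * ?N (tclass m E p)"
    if p: "p \<in> free_space m E" for c p
  proof (cases "c = 0")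
    case True
    have "?N (tclass m E (pm_scale c p)) \<le> weight (pm_scale c p)"
      using p by (intro nrm_tclass_le in_tclass_self free_space_closed)
    then show ?thesis by (simp add: True weight_scale)
  next
    case False
    have "?N (tclass m E (pm_scale c p)) / norm c \<le> ?N (tclass m E p)"
    proof (rule nrm_tclass_ge[OF p])
      fix q assume "q \<in> tclass m E p"
      then have "(pm_scale c p, pm_scale c q) \<in> tensor_equiv m E"
        using quotient_module.scale_cong[OF quotient_module_tensor_space, of p q m E c] by simp
      then have "?N (tclass m E (pm_scale c p)) \<le> weight (pm_scale c q)"
        using p by (intro nrm_tclass_le free_space_closed) auto
      then show "?N (tclass m E (pm_scale c p)) / norm c \<le> weight q"
        using False by (simp add: weight_scale pos_divide_le_eq mult.commute)
    qed
    then show ?thesis using False by (simp add: pos_divide_le_eq mult.commute)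
  qed
  show ?thesis
  proof
    fix A assume "A \<in> carrier (tensor_space m E)"
    then obtain p where p: "p \<in> free_space m E" and A: "A = tclass m E p" by (rule tclass_cases)
    show "0 \<le> ?N A"
      unfolding A by (rule nrm_tclass_ge[OF p]) (auto simp: tensor_equiv_iff weight_nonneg)
    show "?N (c \<odot>\<^bsub>tensor_space m E\<^esub> A) = norm c * ?N A" for c
    proof (cases "c = 0")
      case True
      then show ?thesis
        using scale_le[OF p, of 0] \<open>0 \<le> ?N A\<close> p
          nrm_tclass_ge[of "pm_scale 0 p" 0] by (auto simp: A tclass_scale tensor_equiv_iff weight_nonneg free_space_closed intro!: antisym)
    next
      case False
      have "?N A = ?N (tclass m E (pm_scale (inverse c) (pm_scale c p)))"
        using False by (simp add: A)
      also have "\<dots> \<le> inverse (norm c) * ?N (tclass m E (pm_scale c p))"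
        using scale_le[OF free_space_closed(4)[OF p], of "inverse c" c] by (simp add: norm_inverse)
      finally have "norm c * ?N A \<le> ?N (tclass m E (pm_scale c p))"
        using False by (simp add: field_simps)
      then show ?thesis
        using scale_le[OF p, of c] p by (simp add: A tclass_scale)
    qed
    fix B assume "B \<in> carrier (tensor_space m E)"
    then obtain q where q: "q \<in> free_space m E" and B: "B = tclass m E q" by (rule tclass_cases)
    \<comment> \<open>The infima are taken one after the other: over representations of
      \<open>p\<close> with \<open>q'\<close> fixed, and afterwards over \<open>q'\<close>.\<close>
    have "?N (tclass m E (p + q)) - weight q' \<le> ?N (tclass m E p)" if q': "q' \<in> tclass m E q" for q'
    proof (rule nrm_tclass_ge[OF p])
      fix p' assume p': "p' \<in> tclass m E p"
      have "(p + q, p' + q') \<in> tensor_equiv m E"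
        using quotient_module.add_cong[OF quotient_module_tensor_space, of p p' m E q q'] p' q' by simp
      then have "?N (tclass m E (p + q)) \<le> weight (p' + q')"
        using p q by (intro nrm_tclass_le free_space_closed) auto
      also have "\<dots> \<le> weight p' + weight q'"
        using p' q' by (intro weight_add) (auto simp: tensor_equiv_iff)
      finally show "?N (tclass m E (p + q)) - weight q' \<le> weight p'" by simp
    qed
    then have "?N (tclass m E (p + q)) - ?N (tclass m E p) \<le> ?N (tclass m E q)"
      by (intro nrm_tclass_ge[OF q]) (auto simp: diff_le_eq add.commute)
    then show "?N (A \<oplus>\<^bsub>tensor_space m E\<^esub> B) \<le> ?N A + ?N B"
      using p q by (simp add: A B tclass_add)
  qed
qed

section \<open>Elementary tensors and linearization\<close>

definition tensor :: "(nat \<Rightarrow> 'a) \<Rightarrow> ((nat \<Rightarrow> 'a) \<Rightarrow>\<^sub>0 'k) set" where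
  "tensor x = tclass m E (Poly_Mapping.single x 1)"

lemma tensor_closed: "x \<in> tuples m E \<Longrightarrow> tensor x \<in> carrier (tensor_space m E)"
  by (simp add: tensor_def tclass_closed free_space_closed)

text \<open>The single formal summand is one of the representations over which the infimum is
  taken.\<close>

lemma nrm_tensor_le: "x \<in> tuples m E \<Longrightarrow> nrm (tensor_space m E) (tensor x) \<le> nprod x"
  using nrm_tclass_le[OF free_space_closed(5) in_tclass_self[OF free_space_closed(5)], of x 1]
  by (simp add: tensor_def weight_single)

lemma multilinear_tensor: "multilinear m E (tensor_space m E) tensor"
  unfolding multilinear_def
proof (intro ballI conjI allI)
  fix x i a assume x: "x \<in> tuples m E" and i: "i \<in> {1..m}" and a: "a \<in> carrier (E i)"
  show "tensor (x(i := c \<odot>\<^bsub>E i\<^esub> a)) = c \<odot>\<^bsub>tensor_space m E\<^esub> tensor (x(i := a))" for c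
  proof -
    \<comment> \<open>Multilinearity of the elementary tensor is what the relations impose: the two
      sides differ by a generator of the span divided out.\<close>
    have "Poly_Mapping.single (x(i := c \<odot>\<^bsub>E i\<^esub> a)) 1 - pm_scale c (Poly_Mapping.single (x(i := a)) 1)
        \<in> tensor_relations m E"
      using x i a unfolding tensor_relations_def by blast
    then show ?thesis
      using x i a E_closed(2)[OF i a, of c] unfolding tensor_def
      by (simp add: tclass_scale free_space_closed tuples_fun_upd tclass_eq_iff tensor_equiv_iff pm.span_base
          del: atLeastAtMost_iff)
  qed
  fix b assume b: "b \<in> carrier (E i)"
  have "Poly_Mapping.single (x(i := a \<oplus>\<^bsub>E i\<^esub> b)) 1 - Poly_Mapping.single (x(i := a)) 1
      - Poly_Mapping.single (x(i := b)) 1 \<in> tensor_relations m E"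
    using x i a b unfolding tensor_relations_def by blast
  then have "Poly_Mapping.single (x(i := a \<oplus>\<^bsub>E i\<^esub> b)) 1 - (Poly_Mapping.single (x(i := a)) 1
      + Poly_Mapping.single (x(i := b)) 1) \<in> pm.span (tensor_relations m E)"
    by (simp add: pm.span_base diff_diff_eq)
  then show "tensor (x(i := a \<oplus>\<^bsub>E i\<^esub> b))
      = tensor (x(i := a)) \<oplus>\<^bsub>tensor_space m E\<^esub> tensor (x(i := b))"
    using x i a b E_closed(1)[OF i a b] unfolding tensor_def
    by (simp add: tclass_add free_space_closed tuples_fun_upd tclass_eq_iff tensor_equiv_iff
        del: atLeastAtMost_iff)
qed

text \<open>Universal property of the projective tensor product. The linear extension
  \<open>L\<close> of \<open>T\<close> to formal sums kills the relations, hence is constant on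
  classes, and every representation of a tensor bounds its image by \<open>C\<close> times the
  weight.\<close>

lemma tensor_space_lift:
  assumes "seminormed_space W" and T: "multilinear m E W T" "T \<in> tuples m E \<rightarrow> carrier W"
    and C: "0 < C" "\<And>x. x \<in> tuples m E \<Longrightarrow> nrm W (T x) \<le> C * nprod x"
  shows "\<exists>u. lin_map (tensor_space m E) W u \<and>
    (\<forall>A\<in>carrier (tensor_space m E). nrm W (u A) \<le> C * nrm (tensor_space m E) A) \<and>
    (\<forall>x\<in>tuples m E. u (tensor x) = T x)"
proof -
  interpret W: seminormed_space W by fact
  define L where "L p = finsum W (\<lambda>x. Poly_Mapping.lookup p x \<odot>\<^bsub>W\<^esub> T x) (Poly_Mapping.keys p)" for p
  have Tcar: "T x \<in> carrier W" if "x \<in> tuples m E" for x using T that by auto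
  \<comment> \<open>Supports vary under addition and scaling, so \<open>L\<close> must be computable
    over any larger finite set of tuples.\<close>
  have L_superset: "L p = finsum W (\<lambda>x. Poly_Mapping.lookup p x \<odot>\<^bsub>W\<^esub> T x) S"
    if "finite S" "Poly_Mapping.keys p \<subseteq> S" "S \<subseteq> tuples m E" for p S
    unfolding L_def using that Tcar
    by (intro W.add.finprod_mono_neutral_cong_left) (auto simp: in_keys_iff)
  have L_closed: "L p \<in> carrier W" if "p \<in> free_space m E" for p
    unfolding L_def using that Tcar by (intro W.finsum_closed) (auto simp: free_space_def)
  have L_add: "L (p + q) = L p \<oplus>\<^bsub>W\<^esub> L q" if "p \<in> free_space m E" "q \<in> free_space m E" for p q
  proof -
    let ?S = "Poly_Mapping.keys p \<union> Poly_Mapping.keys q"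
    have S: "finite ?S" "?S \<subseteq> tuples m E" using that by (auto simp: free_space_def)
    have "L (p + q) = finsum W (\<lambda>x. Poly_Mapping.lookup (p + q) x \<odot>\<^bsub>W\<^esub> T x) ?S"
      by (rule L_superset) (use S Poly_Mapping.keys_add[of p q] in auto)
    also have "\<dots> = finsum W (\<lambda>x. Poly_Mapping.lookup p x \<odot>\<^bsub>W\<^esub> T x \<oplus>\<^bsub>W\<^esub> Poly_Mapping.lookup q x \<odot>\<^bsub>W\<^esub> T x) ?S"
      using S Tcar by (intro W.finsum_cong') (auto simp: lookup_add W.scale_add_left)
    also have "\<dots> = L p \<oplus>\<^bsub>W\<^esub> L q"
      using S Tcar L_superset[of ?S p] L_superset[of ?S q] by (subst W.finsum_addf) auto
    finally show ?thesis .
  qed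
  have L_scale: "L (pm_scale c p) = c \<odot>\<^bsub>W\<^esub> L p" if "p \<in> free_space m E" for p c
  proof -
    have S: "Poly_Mapping.keys p \<subseteq> tuples m E" using that by (auto simp: free_space_def)
    have *: "c \<odot>\<^bsub>W\<^esub> finsum W g S = finsum W (\<lambda>x. c \<odot>\<^bsub>W\<^esub> g x) S"
      if "finite S" "g \<in> S \<rightarrow> carrier W" for g and S :: "(nat \<Rightarrow> 'a) set"
      using that
    proof (induction S rule: finite_induct)
      case (insert x S)
      then show ?case
        by (simp add: W.finsum_insert W.finsum_closed W.scale_add_right Pi_iff)
    qed simp
    have "L (pm_scale c p) = finsum W (\<lambda>x. (c * Poly_Mapping.lookup p x) \<odot>\<^bsub>W\<^esub> T x) (Poly_Mapping.keys p)"
      using L_superset[OF finite_keys keys_pm_scale S, of c] by simp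
    also have "\<dots> = finsum W (\<lambda>x. c \<odot>\<^bsub>W\<^esub> (Poly_Mapping.lookup p x \<odot>\<^bsub>W\<^esub> T x)) (Poly_Mapping.keys p)"
      using S Tcar by (intro W.finsum_cong') (auto simp: W.scale_scale)
    also have "\<dots> = c \<odot>\<^bsub>W\<^esub> L p"
      unfolding L_def using S Tcar by (subst *) auto
    finally show ?thesis .
  qed
  have L_diff: "L (p - q) = L p \<ominus>\<^bsub>W\<^esub> L q" if "p \<in> free_space m E" "q \<in> free_space m E" for p q
  proof -
    have "p - q = p + pm_scale (-1) q" by simp
    then show ?thesis
      using that by (simp only: L_add L_scale free_space_closed W.diff_eq_scale L_closed)
  qed
  have L_single: "L (Poly_Mapping.single x 1) = T x" if "x \<in> tuples m E" for x
    using Tcar[OF that] by (simp add: L_def)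
  have L_nrm: "nrm W (L p) \<le> C * weight p" if "p \<in> free_space m E" for p
  proof -
    have *: "nrm W (finsum W g S) \<le> (\<Sum>x\<in>S. nrm W (g x))"
      if "finite S" "g \<in> S \<rightarrow> carrier W" for g and S :: "(nat \<Rightarrow> 'a) set"
      using that
    proof (induction S rule: finite_induct)
      case (insert x S)
      then show ?case
        using W.seminorm_triangle[of "g x" "finsum W g S"] by force
    qed simp
    have S: "Poly_Mapping.keys p \<subseteq> tuples m E" using that by (auto simp: free_space_def)
    have "nrm W (L p) \<le> (\<Sum>x\<in>Poly_Mapping.keys p. nrm W (Poly_Mapping.lookup p x \<odot>\<^bsub>W\<^esub> T x))"
      unfolding L_def using S Tcar by (intro *) auto
    also have "\<dots> \<le> (\<Sum>x\<in>Poly_Mapping.keys p. C * (norm (Poly_Mapping.lookup p x) * nprod x))"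
    proof (rule sum_mono)
      fix x assume "x \<in> Poly_Mapping.keys p"
      then have x: "x \<in> tuples m E" using S by auto
      show "nrm W (Poly_Mapping.lookup p x \<odot>\<^bsub>W\<^esub> T x) \<le> C * (norm (Poly_Mapping.lookup p x) * nprod x)"
        using mult_left_mono[OF C(2)[OF x] norm_ge_zero[of "Poly_Mapping.lookup p x"]] Tcar[OF x]
        by (simp add: W.seminorm_scale mult.left_commute)
    qed
    finally show ?thesis by (simp add: weight_def sum_distrib_left)
  qed
  \<comment> \<open>The right-hand side is a subspace, so only the generators need checking.
    Membership in \<open>free_space m E\<close> is included because \<open>L\<close> is linear only
    there.\<close>
  have "pm.span (tensor_relations m E) \<subseteq> {p \<in> free_space m E. L p = \<zero>\<^bsub>W\<^esub>}"
  proof (rule pm.span_minimal)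
    show "pm.subspace {p \<in> free_space m E. L p = \<zero>\<^bsub>W\<^esub>}"
      by (rule pm.subspaceI) (auto simp: free_space_closed L_add L_scale L_def[of 0])
    show "tensor_relations m E \<subseteq> {p \<in> free_space m E. L p = \<zero>\<^bsub>W\<^esub>}"
    proof
      fix p assume "p \<in> tensor_relations m E"
      then consider
        x i a b where "x \<in> tuples m E" "i \<in> {1..m}" "a \<in> carrier (E i)" "b \<in> carrier (E i)"
          "p = Poly_Mapping.single (x(i := a \<oplus>\<^bsub>E i\<^esub> b)) 1
            - Poly_Mapping.single (x(i := a)) 1 - Poly_Mapping.single (x(i := b)) 1"
        | x i c a where "x \<in> tuples m E" "i \<in> {1..m}" "a \<in> carrier (E i)"
          "p = Poly_Mapping.single (x(i := c \<odot>\<^bsub>E i\<^esub> a)) 1 - pm_scale c (Poly_Mapping.single (x(i := a)) 1)"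
        unfolding tensor_relations_def by blast
      then show "p \<in> {p \<in> free_space m E. L p = \<zero>\<^bsub>W\<^esub>}"
      proof cases
        case 1
        note tup = tuples_fun_upd[OF 1(1,2)]
        note car = tup[OF 1(3)] tup[OF 1(4)] tup[OF E_closed(1)[OF 1(2,3,4)]]
        have "L p = T (x(i := a \<oplus>\<^bsub>E i\<^esub> b)) \<ominus>\<^bsub>W\<^esub> T (x(i := a)) \<ominus>\<^bsub>W\<^esub> T (x(i := b))"
          unfolding 1(5) using car by (simp add: L_diff L_single free_space_closed)
        also have "\<dots> = \<zero>\<^bsub>W\<^esub>"
          using Tcar[OF car(1)] Tcar[OF car(2)] multilinearD(1)[OF T(1) 1(1,2,3,4)]
          W.a_comm[of "T (x(i := a))" "T (x(i := b))"]
          by (simp add: W.minus_eq W.a_assoc W.r_neg W.r_neg1 W.r_neg2)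
        finally show ?thesis unfolding 1(5) using car by (simp add: free_space_closed)
      next
        case 2
        note tup = tuples_fun_upd[OF 2(1,2)]
        note car = tup[OF 2(3)] tup[OF E_closed(2)[OF 2(2,3)]]
        have "L p = T (x(i := c \<odot>\<^bsub>E i\<^esub> a)) \<ominus>\<^bsub>W\<^esub> c \<odot>\<^bsub>W\<^esub> T (x(i := a))"
          unfolding 2(4) using car by (simp add: L_diff L_scale L_single free_space_closed)
        also have "\<dots> = \<zero>\<^bsub>W\<^esub>"
          using Tcar[OF car(1)] multilinearD(2)[OF T(1) 2(1,2,3)] by (simp add: W.diff_self)
        finally show ?thesis unfolding 2(4) using car by (simp add: free_space_closed)
      qed
    qed
  qed
  note span_zero = subsetD[OF this]
  have L_cong: "L q = L p" if "(p, q) \<in> tensor_equiv m E" for p q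
    using that span_zero[of "p - q"] W.diff_add[of "L p" "L q"] L_diff[of p q] L_closed[of p] L_closed[of q]
    by (simp add: tensor_equiv_iff)
  \<comment> \<open>The choice is harmless: by \<open>L_cong\<close> all elements of a class have
    the same image.\<close>
  define u where "u A = L (SOME p. p \<in> A)" for A
  have u: "u (tclass m E p) = L p" if "p \<in> free_space m E" for p
    using someI[of "\<lambda>q. q \<in> tclass m E p", OF in_tclass_self[OF that]]
    by (auto simp: u_def intro: L_cong)
  show ?thesis
  proof (intro exI[of _ u] conjI ballI)
    show "lin_map (tensor_space m E) W u"
      unfolding lin_map_def
      by (auto simp: u L_closed L_add L_scale tclass_add tclass_scale free_space_closed
          elim!: tclass_cases)
    fix A assume "A \<in> carrier (tensor_space m E)"
    then obtain p where p: "p \<in> free_space m E" and A: "A = tclass m E p" by (rule tclass_cases)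
    \<comment> \<open>Dividing by \<open>C > 0\<close> leaves a lower bound for all weights of the
      class, which passes to the infimum.\<close>
    have "nrm W (L p) / C \<le> nrm (tensor_space m E) A"
      unfolding A
    proof (rule nrm_tclass_ge[OF p])
      fix q assume "q \<in> tclass m E p"
      then have "nrm W (L p) \<le> C * weight q"
        using L_nrm[of q] L_cong[of p q] by (auto simp: tensor_equiv_iff)
      then show "nrm W (L p) / C \<le> weight q" using C(1) by (simp add: pos_divide_le_eq mult.commute)
    qed
    then show "nrm W (u A) \<le> C * nrm (tensor_space m E) A"
      using C(1) p by (simp add: A u pos_divide_le_eq mult.commute)
  next
    show "u (tensor x) = T x" if "x \<in> tuples m E" for x
      using that by (simp add: tensor_def u free_space_closed L_single)
  qed
qed

end

section \<open>The two classes of operators\<close>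

lemma cont_multilinear_L_WDP_star_ev:
  assumes "\<And>i. i \<in> {1..m} \<Longrightarrow> normed_space (E i)" "\<And>i. i \<in> {1..m} \<Longrightarrow> schur_property (E i)"
    and "banach_space F" and T: "T \<in> cont_multilinear m E F"
  shows "T \<in> L_WDP_star_ev m E F"
proof -
  interpret F: banach_space F by fact
  let ?X = "product_topology (\<lambda>i. norm_topology (E i)) {1..m}"
  have "(\<lambda>j. \<phi> j (T (\<lambda>i\<in>{1..m}. x i j))) \<longlonglongrightarrow> f (T a)"
    if a: "a \<in> tuples m E" and x: "\<forall>i\<in>{1..m}. weakly_converges (E i) (x i) (a i)"
      and \<phi>: "weak_star_converges F \<phi> f" for a x \<phi> f
  proof -
    have xcar: "x i j \<in> carrier (E i)" if "i \<in> {1..m}" for i j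
      using bspec[OF x that] by (auto simp: weakly_converges_def)
    have tup: "(\<lambda>i\<in>{1..m}. x i j) \<in> tuples m E" for j
      using xcar by (rule restrict_in_tuples)
    \<comment> \<open>Convergence in the product topology is coordinatewise, so the Schur property
      of each \<open>E i\<close> gives it slot by slot.\<close>
    have "limitin ?X (\<lambda>j. \<lambda>i\<in>{1..m}. x i j) a sequentially"
      unfolding limitin_componentwise
    proof (intro conjI ballI always_eventually allI)
      show "a \<in> extensional {1..m}" using a by (auto simp: tuples_def PiE_iff)
      have "topspace ?X = tuples m E"
        by (auto simp: tuples_def intro!: PiE_cong normed_space.topspace_norm_topology assms(1))
      then show "(\<lambda>i\<in>{1..m}. x i j) \<in> topspace ?X" for j using tup by simp
      fix i assume i: "i \<in> {1..m}"
      interpret Ei: normed_space "E i" by (rule assms(1)[OF i])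
      have "Ei.norm_tendsto (x i) (a i)"
        using x i assms(2)[OF i] by (intro schur_norm_tendsto Ei.normed_space_axioms) auto
      then have "limitin (norm_topology (E i)) (x i) (a i) sequentially"
        by (simp add: Ei.norm_tendsto_def Ei.limitin_norm_topology_iff)
      moreover have "(\<lambda>j. (\<lambda>i\<in>{1..m}. x i j) i) = x i" using i by auto
      ultimately show "limitin (norm_topology (E i)) (\<lambda>j. (\<lambda>i\<in>{1..m}. x i j) i) (a i) sequentially"
        by simp
    qed
    then have "limitin (norm_topology F) (T \<circ> (\<lambda>j. \<lambda>i\<in>{1..m}. x i j)) (T a) sequentially"
      using T by (intro continuous_map_limit[of ?X]) (auto simp: cont_multilinear_def)
    moreover have "T (\<lambda>i\<in>{1..m}. x i j) \<in> carrier F" for j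
      using T tup[of j] by (auto simp: cont_multilinear_def)
    ultimately have "F.norm_tendsto (\<lambda>j. T (\<lambda>i\<in>{1..m}. x i j)) (T a)"
      by (simp add: F.norm_tendsto_def F.limitin_norm_topology_iff o_def)
    then show ?thesis by (rule F.weak_star_norm_tendsto[OF \<phi>])
  qed
  then show ?thesis using T by (simp add: L_WDP_star_ev_def)
qed

text \<open>The factorization is \<open>T = (v \<circ> projr) \<circ> S\<close>: \<open>S\<close>
  sends a tuple to the copy of the constant class of its elementary tensor, and \<open>v\<close>
  extends the linearization of \<open>T\<close> to the completion.\<close>

lemma cont_multilinear_DP_comp_L:
  fixes E :: "nat \<Rightarrow> ('k::real_normed_field, 'a) normed_module" and F :: "('k, 'b) normed_module"
  assumes "1 \<le> m" "\<And>i. i \<in> {1..m} \<Longrightarrow> normed_space (E i)"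
    and "banach_space F" and schur: "schur_property (proj_tensor m E)"
    and T: "T \<in> cont_multilinear m E F"
  shows "T \<in> DP_comp_L TYPE('g + ('k, 'a) tensor) m E F"
proof -
  interpret F: banach_space F by fact
  interpret E: normed_family m E by (rule normed_family.intro) (rule assms(2))
  let ?V = "tensor_space m E" and ?P = "proj_tensor m E"
  interpret V: seminormed_space ?V by (rule E.seminormed_space_tensor_space)
  interpret P: banach_space ?P unfolding proj_tensor_def by (rule V.banach_space_completion)
  define G where "G = (Inr_copy ?P :: ('k, 'g + ('k, 'a) tensor) normed_module)"
  have "banach_space G"
    unfolding G_def by (rule banach_space_Inr_copy[OF P.banach_space_axioms])
  interpret G: banach_space G by fact
  have T': "multilinear m E F T" "T \<in> tuples m E \<rightarrow> carrier F"
    using T by (auto simp: cont_multilinear_def)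
  obtain C where C: "0 < C" "\<And>x. x \<in> tuples m E \<Longrightarrow> nrm F (T x) \<le> C * E.nprod x"
    using E.cont_multilinear_bounded[OF F.normed_space_axioms \<open>1 \<le> m\<close> T] by blast
  obtain u where u: "lin_map ?V F u" "\<And>A. A \<in> carrier ?V \<Longrightarrow> nrm F (u A) \<le> C * nrm ?V A"
    "\<And>x. x \<in> tuples m E \<Longrightarrow> u (E.tensor x) = T x"
    using E.tensor_space_lift[OF F.seminormed_space_axioms T' C] by blast
  obtain v where v: "lin_map ?P F v" "\<And>A. A \<in> carrier ?P \<Longrightarrow> nrm F (v A) \<le> C * nrm ?P A"
    "\<And>A. A \<in> carrier ?V \<Longrightarrow> v (cauchy_equiv ?V `` {\<lambda>_. A}) = u A"
    using V.lin_map_extend_completion[OF \<open>banach_space F\<close> u(1,2)] unfolding proj_tensor_def by blast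
  define S where "S = (\<lambda>x\<in>tuples m E. Inr (cauchy_equiv ?V `` {\<lambda>_. E.tensor x}) :: 'g + ('k, 'a) tensor)"
  have tcar: "E.tensor \<in> tuples m E \<rightarrow> carrier ?V" by (auto intro: E.tensor_closed)
  \<comment> \<open>Linearity of the canonical map from the algebraic tensor product into
    \<open>G\<close> lets \<open>S\<close> inherit multilinearity from
    \<open>E.tensor\<close>.\<close>
  have \<iota>: "lin_map ?V G (\<lambda>A. Inr (cauchy_equiv ?V `` {\<lambda>_. A}))"
    by (auto simp: lin_map_def G_def proj_tensor_def V.completion_class_closed V.cauchy_seqs_const
        V.completion_class_add V.completion_class_scale)
  have Sml: "multilinear m E G S"
    unfolding S_def
    by (intro E.multilinear_restrict multilinear_lin_map[OF E.multilinear_tensor tcar \<iota>])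
  have Scar: "S \<in> tuples m E \<rightarrow>\<^sub>E carrier G"
    using lin_mapD(1)[OF \<iota>] by (auto simp: S_def E.tensor_closed)
  have "nrm G (S x) \<le> 1 * E.nprod x" if "x \<in> tuples m E" for x
    using that E.nrm_tensor_le[OF that] V.nrm_completion_const[OF E.tensor_closed[OF that]]
    by (simp add: S_def G_def proj_tensor_def)
  then have "continuous_map (product_topology (\<lambda>i. norm_topology (E i)) {1..m}) (norm_topology G) S"
    using Scar by (intro E.continuous_map_bounded_multilinear[OF G.normed_space_axioms Sml, of 1])
      (auto simp: PiE_iff)
  then have S: "S \<in> cont_multilinear m E G"
    using Sml Scar by (simp add: cont_multilinear_def)
  have vG: "lin_map G F (v \<circ> projr)" "\<And>x. x \<in> carrier G \<Longrightarrow> nrm F ((v \<circ> projr) x) \<le> C * nrm G x"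
    using v by (auto simp: lin_map_def G_def)
  \<comment> \<open>The only use of the Schur property of the tensor product: a weakly null sequence
    in \<open>G\<close> projects to a weakly null, hence norm null, sequence in \<open>?P\<close>,
    and the bound by \<open>C\<close> carries this to \<open>F\<close>.\<close>
  have "(\<lambda>j. nrm F ((v \<circ> projr) (y j))) \<longlonglongrightarrow> 0" if y: "weakly_converges G y \<zero>\<^bsub>G\<^esub>" for y
  proof -
    have ycar: "y j \<in> carrier G" for j using y by (auto simp: weakly_converges_def)
    have "weakly_converges ?P (\<lambda>j. projr (y j)) \<zero>\<^bsub>?P\<^esub>"
      using P.weakly_converges_Inr_copyD[OF y[unfolded G_def]] by simp
    then have "P.norm_tendsto (\<lambda>j. projr (y j)) \<zero>\<^bsub>?P\<^esub>"
      by (rule schur_norm_tendsto[OF P.normed_space_axioms schur])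
    from P.tendsto_nrm[OF this] have "(\<lambda>j. nrm G (y j)) \<longlonglongrightarrow> 0" by (simp add: G_def)
    from tendsto_mult_right_zero[OF this, of C] show ?thesis
    proof (rule tendsto_zero_dominated)
      show "nrm F ((v \<circ> projr) (y j)) \<le> C * nrm G (y j)" for j by (rule vG(2)[OF ycar])
      show "0 \<le> nrm F ((v \<circ> projr) (y j))" for j
        by (rule F.nrm_nonneg[OF lin_mapD(1)[OF vG(1) ycar]])
    qed
  qed
  then have "v \<circ> projr \<in> dunford_pettis G F"
    using vG by (auto simp: dunford_pettis_def)
  moreover have "\<forall>x\<in>tuples m E. T x = (v \<circ> projr) (S x)"
    by (simp add: S_def v(3) u(3) E.tensor_closed)
  ultimately show ?thesis
    using T S \<open>banach_space G\<close> unfolding DP_comp_L_def by blast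
qed

theorem proposition4p9:
  fixes m :: nat
    and E :: "nat \<Rightarrow> ('k::real_normed_field, 'a) normed_module"
    and F :: "('k, 'b) normed_module"
  assumes "m \<ge> 1"
    and "\<And>i. i \<in> {1..m} \<Longrightarrow> banach_space (E i)"
    and "banach_space F"
    and "\<And>i. i \<in> {1..m} \<Longrightarrow> schur_property (E i)"
    and "schur_property (proj_tensor m E)"
  shows "DP_comp_L TYPE('g + ('k, 'a) tensor) m E F = L_WDP_star_ev m E F"
proof -
  have norm: "\<And>i. i \<in> {1..m} \<Longrightarrow> normed_space (E i)"
    using assms(2) by (simp add: banach_space_def)
  \<comment> \<open>Both classes are subsets of \<open>cont_multilinear m E F\<close> by definition,
    so each equality needs only the other inclusion.\<close>
  have "DP_comp_L TYPE('g + ('k, 'a) tensor) m E F = cont_multilinear m E F"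
    using cont_multilinear_DP_comp_L[OF assms(1) norm assms(3,5)]
    by (auto simp: DP_comp_L_def)
  moreover have "L_WDP_star_ev m E F = cont_multilinear m E F"
    using cont_multilinear_L_WDP_star_ev[OF norm assms(4,3)]
    by (auto simp: L_WDP_star_ev_def)
  ultimately show ?thesis by simp
qed

end
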